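(* Let $(\Xi,\mathscr{M})$ be a measurable space, and let $(H_1,\|\cdot\|_{H_1})$, $(H_2,\|\cdot\|_{H_2})$ be two separable Hilbert spaces. Let $\Xi\ni\xi\mapsto A_\xi\in\mathcal{K}(H_1,H_2)$ be a measurable map. Fix any integer $n\ge1$ and assume that $\operatorname{rank}(A_\xi)\ge n$ for all $\xi\in\Xi$. Then there exist measurable maps $$s_i:\Xi\to[0,\infty),\quad u_i:\Xi\to H_1,\quad v_i:\Xi\to H_2,\qquad i=1,\dots,n,$$ such that, for all $\xi\in\Xi$ and all $i,j\in\{1,\dots,n\}$, $s_i(\xi)=\sigma_i(A_\xi)$, $\langle u_i(\xi),u_j(\xi)\rangle_{H_1}=\langle v_i(\xi),v_j(\xi)\rangle_{H_2}=\delta_{i,j}$ and $$\left\|A_\xi-\sum_{i=1}^n s_i(\xi)\langle\cdot,u_i(\xi)\rangle_{H_1}v_i(\xi)\right\|_{op}=\inf_{\substack{L\in\mathcal{K}(H_1,H_2)\\ \operatorname{rank}(L)\le n}}\|A_\xi-L\|_{op}=\sigma_{n+1}(A_\xi).$$ In particular, there exists a measurable map $\Xi\ni\xi\mapsto A_\xi^n\in\mathcal{K}(H_1,H_2)$ mapping each $\xi$ to an optimal $n$-rank approximation of $A_\xi$ (a minimizer of $\|A_\xi-L\|_{op}$ over $L$ with $\operatorname{rank}(L)\le n$). The Hilbert-Schmidt version also holds: if $\Xi\ni\xi\mapsto A_\xi\in\mathcal{S}_2(H_1,H_2)$ is a measurable map into the space of Hilbert-Schmidt operators (equipped with the Hilbert-Schmidt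 norm) and $\operatorname{rank}(A_\xi)\ge n$ for all $\xi\in\Xi$, then there exist measurable maps $s_i:\Xi\to[0,\infty)$, $u_i:\Xi\to H_1$, $v_i:\Xi\to H_2$, $i=1,\dots,n$, such that, for all $\xi\in\Xi$ and all $i,j\in\{1,\dots,n\}$, $s_i(\xi)=\sigma_i(A_\xi)$, $\langle u_i(\xi),u_j(\xi)\rangle_{H_1}=\langle v_i(\xi),v_j(\xi)\rangle_{H_2}=\delta_{i,j}$ and $$\left\|A_\xi-\sum_{i=1}^n s_i(\xi)\langle\cdot,u_i(\xi)\rangle_{H_1}v_i(\xi)\right\|_{HS}=\inf_{\substack{L\in\mathcal{S}_2(H_1,H_2)\\ \operatorname{rank}(L)\le n}}\|A_\xi-L\|_{HS}=\left(\sum_{i\ge n+1}\sigma_i(A_\xi)^2\right)^{1/2};$$ in particular, there exists a measurable map $\Xi\ni\xi\mapsto A_\xi^n\in\mathcal{S}_2(H_1,H_2)$ mapping each $\xi$ to a minimizer of $\|A_\xi-L\|_{HS}$ over $L\in\mathcal{S}_2(H_1,H_2)$ with $\operatorname{rank}(L)\le n$.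
   Context: $\mathcal{K}(H_1,H_2)$ is the space of compact linear operators from $H_1$ to $H_2$ with operator norm $\|\cdot\|_{op}$. For $A\in\mathcal{K}(H_1,H_2)$ and $n\ge1$, $\sigma_n(A):=\inf\{\|A-L\|_{op}:L\in\mathcal{K}(H_1,H_2),\ \operatorname{rank}(L)\le n-1\}$ is the $n$-th singular value. $\mathcal{S}_2(H_1,H_2)$ is the set of $A\in\mathcal{K}(H_1,H_2)$ with $\|A\|_{HS}:=\left(\sum_{i\ge1}\sigma_i(A)^2\right)^{1/2}<\infty$. The rank of an operator is the dimension of its image. All normed spaces carry the Borel $\sigma$-algebra of their norm. Inner products are linear in the first argument, and $\langle\cdot,u\rangle v$ denotes the operator $x\mapsto\langle x,u\rangle v$. *)

theory Defs
  imports "HOL-Analysis.Analysis" "HOL-Library.Extended_Nat"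
begin

text \<open>Scalars: a real normed field that embeds into the complex numbers as a conjugation-closed
  real subalgebra, so exactly the real or the complex field. This treats real and complex Hilbert
  spaces uniformly.\<close>

class real_or_complex = real_normed_field +
  fixes to_complex :: "'a \<Rightarrow> complex"
    and conjugate :: "'a \<Rightarrow> 'a"
  assumes to_complex_add: "to_complex (x + y) = to_complex x + to_complex y"
    and to_complex_mult: "to_complex (x * y) = to_complex x * to_complex y"
    and to_complex_scaleR: "to_complex (r *\<^sub>R x) = r *\<^sub>R to_complex x"
    and norm_to_complex: "norm (to_complex x) = norm x"
    and to_complex_conjugate: "to_complex (conjugate x) = cnj (to_complex x)"

instantiation real :: real_or_complex
begin
definition "to_complex (x::real) = complex_of_real x"
definition "conjugate (x::real) = x"
instance by standard (simp_all add: to_complex_real_def conjugate_real_def scaleR_conv_of_real)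
end

instantiation complex :: real_or_complex
begin
definition "to_complex (x::complex) = x"
definition "conjugate (x::complex) = cnj x"
instance by standard (simp_all add: to_complex_complex_def conjugate_complex_def)
end

text \<open>Completeness is provided by the class \<^class>\<open>banach\<close>; separability is imposed where needed by
  the class \<^class>\<open>second_countable_topology\<close>, which is equivalent for metric spaces.\<close>

locale hilbert_space = vector_space scale
  for scale :: "'k::real_or_complex \<Rightarrow> 'a::banach \<Rightarrow> 'a" +
  fixes ip :: "'a \<Rightarrow> 'a \<Rightarrow> 'k"
  assumes scale_of_real: "scale (of_real r) x = r *\<^sub>R x"
    and ip_add_left: "ip (x + y) z = ip x z + ip y z"
    and ip_scale_left: "ip (scale c x) y = c * ip x y"
    and ip_commute: "ip x y = conjugate (ip y x)"
    and ip_self: "ip x x = of_real ((norm x)\<^sup>2)"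

lemma hilbert_space_real:
  "hilbert_space scaleR (inner :: 'a::{real_inner,banach} \<Rightarrow> 'a \<Rightarrow> real)"
  by unfold_locales
    (simp_all add: scaleR_add_right scaleR_add_left inner_add_left inner_add_right
      conjugate_real_def inner_commute power2_norm_eq_inner)

lemma hilbert_space_complex: "hilbert_space (*) (\<lambda>x y :: complex. x * cnj y)"
  by unfold_locales
    (simp_all add: algebra_simps scaleR_conv_of_real conjugate_complex_def
      complex_norm_square[symmetric])

text \<open>The type \<^typ>\<open>'a \<Rightarrow>\<^sub>L 'b\<close> consists of the bounded real-linear maps with the operator norm, hence
  linearity over the scalar field is required separately.\<close>

definition compact_ops ::
  "('k::real_or_complex \<Rightarrow> 'a::real_normed_vector \<Rightarrow> 'a) \<Rightarrow> ('k \<Rightarrow> 'b::real_normed_vector \<Rightarrow> 'b)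
    \<Rightarrow> ('a \<Rightarrow>\<^sub>L 'b) set" where
  "compact_ops sc1 sc2 =
     {A. (\<forall>c x. blinfun_apply A (sc1 c x) = sc2 c (blinfun_apply A x)) \<and>
         (\<forall>S. bounded S \<longrightarrow> compact (closure (blinfun_apply A ` S)))}"

text \<open>The library's \<open>dim\<close> of an infinite-dimensional space is \<open>0\<close>, hence the case distinction.\<close>

definition op_rank ::
  "('k::real_or_complex \<Rightarrow> 'b::real_normed_vector \<Rightarrow> 'b) \<Rightarrow> ('a::real_normed_vector \<Rightarrow>\<^sub>L 'b) \<Rightarrow> enat"
  where
  "op_rank sc2 L =
     (if \<exists>B. finite B \<and> range (blinfun_apply L) \<subseteq> module.span sc2 B
      then enat (vector_space.dim sc2 (range (blinfun_apply L))) else \<infinity>)"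

text \<open>Singular values are indexed from 1.\<close>

definition sing_val ::
  "('k::real_or_complex \<Rightarrow> 'a::real_normed_vector \<Rightarrow> 'a) \<Rightarrow> ('k \<Rightarrow> 'b::real_normed_vector \<Rightarrow> 'b)
    \<Rightarrow> nat \<Rightarrow> ('a \<Rightarrow>\<^sub>L 'b) \<Rightarrow> real" where
  "sing_val sc1 sc2 n A =
     (INF L\<in>{L \<in> compact_ops sc1 sc2. op_rank sc2 L \<le> enat (n - 1)}. norm (A - L))"

definition hs_ops ::
  "('k::real_or_complex \<Rightarrow> 'a::real_normed_vector \<Rightarrow> 'a) \<Rightarrow> ('k \<Rightarrow> 'b::real_normed_vector \<Rightarrow> 'b)
    \<Rightarrow> ('a \<Rightarrow>\<^sub>L 'b) set" where
  "hs_ops sc1 sc2 =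
     {A \<in> compact_ops sc1 sc2. (\<lambda>i. (sing_val sc1 sc2 i A)\<^sup>2) summable_on {1..}}"

definition hs_norm ::
  "('k::real_or_complex \<Rightarrow> 'a::real_normed_vector \<Rightarrow> 'a) \<Rightarrow> ('k \<Rightarrow> 'b::real_normed_vector \<Rightarrow> 'b)
    \<Rightarrow> ('a \<Rightarrow>\<^sub>L 'b) \<Rightarrow> real" where
  "hs_norm sc1 sc2 A = sqrt (\<Sum>\<^sub>\<infinity>i\<in>{1..}. (sing_val sc1 sc2 i A)\<^sup>2)"

definition compact_borel ::
  "('k::real_or_complex \<Rightarrow> 'a::real_normed_vector \<Rightarrow> 'a) \<Rightarrow> ('k \<Rightarrow> 'b::real_normed_vector \<Rightarrow> 'b)
    \<Rightarrow> ('a \<Rightarrow>\<^sub>L 'b) measure" where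
  "compact_borel sc1 sc2 = restrict_space borel (compact_ops sc1 sc2)"

text \<open>The sigma-algebra generated by the sets that are open for the Hilbert-Schmidt norm, not for the
  operator norm of the ambient type.\<close>

definition hs_borel ::
  "('k::real_or_complex \<Rightarrow> 'a::real_normed_vector \<Rightarrow> 'a) \<Rightarrow> ('k \<Rightarrow> 'b::real_normed_vector \<Rightarrow> 'b)
    \<Rightarrow> ('a \<Rightarrow>\<^sub>L 'b) measure" where
  "hs_borel sc1 sc2 =
     sigma (hs_ops sc1 sc2)
       {U. U \<subseteq> hs_ops sc1 sc2 \<and>
           (\<forall>A\<in>U. \<exists>e>0. \<forall>B\<in>hs_ops sc1 sc2. hs_norm sc1 sc2 (B - A) < e \<longrightarrow> B \<in> U)}"

definition rank_one ::
  "('k::real_or_complex \<Rightarrow> 'b::real_normed_vector \<Rightarrow> 'b) \<Rightarrow>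
    ('a::real_normed_vector \<Rightarrow> 'a \<Rightarrow> 'k) \<Rightarrow> 'a \<Rightarrow> 'b \<Rightarrow> ('a \<Rightarrow>\<^sub>L 'b)" where
  "rank_one sc2 ip1 u v = Blinfun (\<lambda>x. sc2 (ip1 x u) v)"

lemma to_complex_inject: "to_complex x = to_complex y \<longleftrightarrow> x = y"
proof -
  have "to_complex (x - y) = to_complex x - to_complex y"
    using to_complex_add[of "x - y" y] by simp
  then show ?thesis
    using norm_to_complex[of "x - y"] by auto
qed

lemma to_complex_of_real: "to_complex (of_real r :: 'k::real_or_complex) = of_real r"
proof -
  have "to_complex (1::'k) * to_complex (1::'k) = to_complex (1::'k) * 1"
    by (simp only: to_complex_mult[symmetric] mult_1_right)
  moreover have "to_complex (1::'k) \<noteq> 0"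
    using norm_to_complex[of "1::'k"] by auto
  ultimately have "to_complex (1::'k) = 1"
    by (metis mult_left_cancel)
  then show ?thesis
    by (simp add: of_real_def to_complex_scaleR)
qed

lemma mult_conjugate: "c * conjugate c = of_real ((norm (c::'k::real_or_complex))\<^sup>2)"
proof -
  have "to_complex (c * conjugate c) = to_complex (of_real ((norm c)\<^sup>2))"
    unfolding to_complex_mult to_complex_conjugate to_complex_of_real
    by (metis complex_norm_square norm_to_complex)
  then show ?thesis by (rule to_complex_inject[THEN iffD1])
qed

lemma conjugate_mult: "conjugate (c * d) = conjugate c * conjugate (d::'k::real_or_complex)"
  by (rule to_complex_inject[THEN iffD1])
    (simp only: to_complex_conjugate to_complex_mult complex_cnj_mult)

lemma conjugate_add: "conjugate (c + d) = conjugate c + conjugate (d::'k::real_or_complex)"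
  by (rule to_complex_inject[THEN iffD1])
    (simp only: to_complex_conjugate to_complex_add complex_cnj_add)

context hilbert_space
begin

lemma ip_add_right: "ip z (x + y) = ip z x + ip z y"
  by (metis ip_commute ip_add_left conjugate_add)

lemma ip_scale_right: "ip x (scale c y) = conjugate c * ip x y"
  by (metis ip_commute ip_scale_left conjugate_mult)

lemma norm_scale: "norm (scale c x) = norm c * norm x"
proof -
  have "of_real ((norm (scale c x))\<^sup>2) = c * conjugate c * ip x x"
    by (simp only: ip_self[symmetric] ip_scale_left ip_scale_right mult.left_commute mult.assoc)
  also have "\<dots> = of_real ((norm c * norm x)\<^sup>2)"
    by (simp add: mult_conjugate ip_self power_mult_distrib)
  finally show ?thesis
    by (simp only: of_real_eq_iff) (simp add: power2_eq_iff_nonneg)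
qed

lemma Cauchy_Schwarz: "norm (ip x u) \<le> norm x * norm u"
proof (cases "u = 0")
  case True
  have "ip x 0 = 0" using ip_add_right[of x 0 0] by simp
  then show ?thesis using True by simp
next
  case False
  define a where "a = ip x u"
  define r where "r = (norm u)\<^sup>2"
  have r: "r > 0" using False by (simp add: r_def)
  define c where "c = - (a / of_real r)"
  have cr: "c * of_real r = - a" using r by (simp add: c_def)
  have ux: "ip u x = conjugate a" unfolding a_def by (rule ip_commute)
  have "of_real ((norm (x + scale c u))\<^sup>2) =
      ip x x + conjugate c * a + c * conjugate a + c * of_real r * conjugate c"
    unfolding ip_self[symmetric] ip_add_left ip_add_right ip_scale_left ip_scale_right
    by (simp add: a_def[symmetric] ux ip_self[of u] r_def algebra_simps)
  also have "\<dots> = ip x x + c * conjugate a"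
    unfolding cr by simp
  also have "\<dots> = of_real ((norm x)\<^sup>2) - (a * conjugate a) / of_real r"
    by (simp add: c_def ip_self)
  also have "\<dots> = of_real ((norm x)\<^sup>2 - (norm a)\<^sup>2 / r)"
    by (simp add: mult_conjugate)
  finally have "(norm (x + scale c u))\<^sup>2 = (norm x)\<^sup>2 - (norm a)\<^sup>2 / r"
    by (simp only: of_real_eq_iff)
  then have "(norm a)\<^sup>2 / r \<le> (norm x)\<^sup>2"
    by (metis zero_le_power2 diff_ge_0_iff_ge)
  then have "(norm a)\<^sup>2 \<le> (norm x * norm u)\<^sup>2"
    using r by (simp add: divide_le_eq r_def power_mult_distrib)
  then show ?thesis
    unfolding a_def by (rule power2_le_imp_le) simp
qed

end

lemma rank_one_apply:
  assumes "hilbert_space sc1 ip1" and "hilbert_space sc2 ip2"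
  shows "blinfun_apply (rank_one sc2 ip1 u v) x = sc2 (ip1 x u) v"
proof -
  interpret H1: hilbert_space sc1 ip1 by fact
  interpret H2: hilbert_space sc2 ip2 by fact
  have "bounded_linear (\<lambda>x. sc2 (ip1 x u) v)"
  proof (rule bounded_linear_intro[where K = "norm u * norm v"])
    fix r x y
    show "sc2 (ip1 (x + y) u) v = sc2 (ip1 x u) v + sc2 (ip1 y u) v"
      by (simp add: H1.ip_add_left H2.scale_left_distrib)
    show "sc2 (ip1 (r *\<^sub>R x) u) v = r *\<^sub>R sc2 (ip1 x u) v"
      by (simp add: H1.scale_of_real[symmetric] H2.scale_of_real[symmetric] H1.ip_scale_left)
    show "norm (sc2 (ip1 x u) v) \<le> norm x * (norm u * norm v)"
      using mult_right_mono[OF H1.Cauchy_Schwarz[of x u], of "norm v"]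
      by (simp add: H2.norm_scale mult.assoc)
  qed
  then show ?thesis
    by (simp add: rank_one_def bounded_linear_Blinfun_apply)
qed

end

theory Submission
  imports Defs
begin

text \<open>A compact operator \<open>A \<noteq> 0\<close> attains its norm: by the parallelogram law a maximizing sequence
  along which \<open>A\<close> converges is Cauchy. If \<open>u\<close> is a unit vector with \<open>\<parallel>A u\<parallel> = \<parallel>A\<parallel>\<close>, then \<open>A\<close> maps the
  orthogonal complement of \<open>u\<close> into that of \<open>A u\<close>, so deflating \<open>A\<close> to \<open>A - \<langle>\<cdot>,u\<rangle> A u\<close> repeatedly
  produces the singular vectors one at a time, and the norm of the \<open>k\<close>-th residual is the
  \<open>(k+1)\<close>-st singular value. No adjoint and no spectral theorem is needed.

  The unit maximizer is selected measurably as follows. The maximizers span the zero set of the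
  positive quadratic form \<open>\<parallel>A\<parallel>\<^sup>2 \<parallel>x\<parallel>\<^sup>2 - \<parallel>A x\<parallel>\<^sup>2\<close>. For a point \<open>d\<close> of a dense sequence, near minimizers
  of \<open>\<parallel>x - d\<parallel>\<^sup>2 + k (\<parallel>A\<parallel>\<^sup>2 \<parallel>x\<parallel>\<^sup>2 - \<parallel>A x\<parallel>\<^sup>2)\<close> taken from the dense sequence converge, by strong convexity,
  to the point of the zero set nearest to \<open>d\<close> as \<open>k\<close> grows. The first nonzero such limit, normalized, is
  the required maximizer. It depends measurably on \<open>A\<close> already for the strong operator topology,
  which is preserved by deflation.\<close>

section \<open>Real and complex scalars\<close>

lemma to_complex_0 [simp]: "to_complex (0::'k::real_or_complex) = 0"
  using to_complex_of_real[of 0, where 'k='k] by simp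

lemma to_complex_minus: "to_complex (- x) = - to_complex (x::'k::real_or_complex)"
  using to_complex_add[of x "- x"] by (simp add: eq_neg_iff_add_eq_0 add.commute)

lemma to_complex_diff: "to_complex (x - y) = to_complex x - to_complex (y::'k::real_or_complex)"
  using to_complex_add[of x "- y"] by (simp add: to_complex_minus)

lemma conjugate_0 [simp]: "conjugate (0::'k::real_or_complex) = 0"
  by (rule to_complex_inject[THEN iffD1]) (simp add: to_complex_conjugate)

lemma conjugate_of_real [simp]: "conjugate (of_real r :: 'k::real_or_complex) = of_real r"
  by (rule to_complex_inject[THEN iffD1]) (simp add: to_complex_conjugate to_complex_of_real)

lemma norm_conjugate [simp]: "norm (conjugate (c::'k::real_or_complex)) = norm c"
  by (metis norm_to_complex to_complex_conjugate complex_mod_cnj)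

text \<open>The class does not assume the scalar field to be locally compact; this is inherited from the
  complex plane, where every real subspace is closed.\<close>
lemma compact_cball_0_real_or_complex: "compact (cball (0::'k::real_or_complex) r)"
proof -
  define R where "R = range (to_complex :: 'k \<Rightarrow> complex)"
  have inj: "inj (to_complex :: 'k \<Rightarrow> complex)"
    by (simp add: inj_on_def to_complex_inject)
  have "subspace R"
  proof (rule subspaceI)
    show "0 \<in> R" unfolding R_def by (metis rangeI to_complex_0)
  next
    fix x y assume "x \<in> R" "y \<in> R"
    then show "x + y \<in> R" unfolding R_def by (auto simp flip: to_complex_add)
  next
    fix c x assume "x \<in> R"
    then show "c *\<^sub>R x \<in> R" unfolding R_def by (auto simp flip: to_complex_scaleR)
  qed
  then have "compact (R \<inter> cball 0 r)"
    by (intro closed_Int_compact closed_subspace) auto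
  \<comment> \<open>\<open>to_complex\<close> is an isometry, so its inverse on \<open>R\<close> is
    one too and \<open>d = e\<close> works.\<close>
  moreover have "continuous_on (R \<inter> cball 0 r) (inv to_complex :: complex \<Rightarrow> 'k)"
  proof (rule continuous_onI)
    fix x' :: complex and e :: real assume "x' \<in> R \<inter> cball 0 r" and e: "0 < e"
    then show "\<exists>d>0. \<forall>y\<in>R \<inter> cball 0 r. dist y x' < d \<longrightarrow>
        dist (inv to_complex y :: 'k) (inv to_complex x') \<le> e"
      using inj
      by (auto intro!: exI[of _ e] simp: R_def dist_norm inv_f_f simp flip: to_complex_diff)
        (auto simp: norm_to_complex)
  qed
  ultimately have "compact ((inv to_complex :: complex \<Rightarrow> 'k) ` (R \<inter> cball 0 r))"
    by (rule compact_continuous_image[rotated])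
  also have "(inv to_complex :: complex \<Rightarrow> 'k) ` (R \<inter> cball 0 r) = cball 0 r"
  proof
    show "inv to_complex ` (R \<inter> cball 0 r) \<subseteq> cball (0::'k) r"
      using inj by (auto simp: R_def norm_to_complex inv_f_f)
    show "cball (0::'k) r \<subseteq> inv to_complex ` (R \<inter> cball 0 r)"
    proof
      fix x :: 'k assume "x \<in> cball 0 r"
      then show "x \<in> inv to_complex ` (R \<inter> cball 0 r)"
        using inj by (intro image_eqI[of _ _ "to_complex x"]) (simp_all add: R_def norm_to_complex inv_f_f)
    qed
  qed
  finally show ?thesis .
qed

section \<open>Orthogonality\<close>

context hilbert_space
begin

lemma ip_zero_left [simp]: "ip 0 x = 0"
  using ip_add_left[of 0 0 x] by simp

lemma ip_zero_right [simp]: "ip x 0 = 0"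
  using ip_add_right[of x 0 0] by simp

lemma ip_minus_left: "ip (- x) y = - ip x y"
  using ip_add_left[of x "- x" y] by (simp add: eq_neg_iff_add_eq_0 add.commute)

lemma ip_diff_left: "ip (x - y) z = ip x z - ip y z"
  using ip_add_left[of x "- y" z] by (simp add: ip_minus_left)

lemma ip_minus_right: "ip x (- y) = - ip x y"
  using ip_add_right[of x y "- y"] by (simp add: eq_neg_iff_add_eq_0 add.commute)

lemma ip_scaleR_left: "ip (r *\<^sub>R x) y = r *\<^sub>R ip x y"
  by (metis ip_scale_left scale_of_real scaleR_conv_of_real)

lemma ip_scaleR_right: "ip x (r *\<^sub>R y) = r *\<^sub>R ip x y"
  by (metis ip_scale_right scale_of_real scaleR_conv_of_real conjugate_of_real)

lemma ip_eq_0_commute: "ip x y = 0 \<longleftrightarrow> ip y x = 0"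
  by (metis ip_commute conjugate_0)

lemma scale_scaleR: "scale c (r *\<^sub>R x) = r *\<^sub>R scale c x"
  by (metis scale_left_commute scale_of_real)

section \<open>Pythagoras and the parallelogram law\<close>

lemma norm_add_square:
  "(norm (x + y))\<^sup>2 = (norm x)\<^sup>2 + (norm y)\<^sup>2 + 2 * Re (to_complex (ip x y))"
proof -
  have self: "(norm z)\<^sup>2 = Re (to_complex (ip z z))" for z
    by (simp add: ip_self to_complex_of_real del: of_real_power)
  have "Re (to_complex (ip y x)) = Re (to_complex (ip x y))"
    by (metis ip_commute to_complex_conjugate complex_cnj(1) complex.sel(1) complex.collapse)
  then show ?thesis
    unfolding self by (simp add: ip_add_left ip_add_right to_complex_add)
qed

lemma norm_add_square_orthogonal:
  "ip x y = 0 \<Longrightarrow> (norm (x + y))\<^sup>2 = (norm x)\<^sup>2 + (norm y)\<^sup>2"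
  by (simp add: norm_add_square)

lemma parallelogram:
  fixes x y :: 'a
  shows "(norm (x + y))\<^sup>2 + (norm (x - y))\<^sup>2 = 2 * (norm x)\<^sup>2 + 2 * (norm y)\<^sup>2"
  using norm_add_square[of x y] norm_add_square[of x "- y"]
  by (simp add: ip_minus_right to_complex_minus)

lemma norm_diff_proj_square:
  assumes "norm u = 1"
  shows "(norm (x - scale (ip x u) u))\<^sup>2 = (norm x)\<^sup>2 - (norm (ip x u))\<^sup>2"
proof -
  have "ip (x - scale (ip x u) u) (scale (ip x u) u) = 0"
    using assms by (simp add: ip_diff_left ip_scale_left ip_scale_right ip_self)
  from norm_add_square_orthogonal[OF this] show ?thesis
    using assms by (simp add: norm_scale)
qed

lemma norm_square_sum_orthonormal:
  assumes "finite I"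
    and "\<And>i j. i \<in> I \<Longrightarrow> j \<in> I \<Longrightarrow> ip (w i) (w j) = (if i = j then 1 else 0)"
  shows "(norm (\<Sum>i\<in>I. scale (c i) (w i)))\<^sup>2 = (\<Sum>i\<in>I. (norm (c i))\<^sup>2)"
  using assms
proof (induction I rule: finite_induct)
  case (insert i I)
  have "ip (scale (c i) (w i)) (\<Sum>j\<in>I. scale (c j) (w j)) = 0"
  proof -
    \<comment> \<open>Stated for all subsets \<open>J\<close> of \<open>I\<close>, so that the inner
      induction leaves the hypotheses on \<open>insert i I\<close> untouched.\<close>
    have "ip (scale (c i) (w i)) (\<Sum>j\<in>J. scale (c j) (w j)) = 0" if "finite J" "J \<subseteq> I" for J
      using that
    proof (induction J rule: finite_induct)
      case (insert j J)
      moreover have "i \<noteq> j" using insert.prems \<open>i \<notin> I\<close> by auto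
      ultimately show ?case
        using \<open>\<And>i' j. i' \<in> insert i I \<Longrightarrow> j \<in> insert i I \<Longrightarrow> _\<close>[of i j]
        by (simp add: ip_add_right ip_scale_left ip_scale_right)
    qed simp
    then show ?thesis using insert.hyps by blast
  qed
  moreover have "norm (w i) = 1"
  proof -
    have "of_real ((norm (w i))\<^sup>2) = (of_real 1 :: 'k)"
      using insert.prems[of i i] by (simp add: ip_self)
    then have "(norm (w i))\<^sup>2 = 1" by (simp only: of_real_eq_iff)
    then show ?thesis using norm_ge_zero[of "w i"] unfolding power2_eq_1_iff by linarith
  qed
  moreover have "(norm (\<Sum>i\<in>I. scale (c i) (w i)))\<^sup>2 = (\<Sum>i\<in>I. (norm (c i))\<^sup>2)"
    using insert.prems by (intro insert.IH) auto
  ultimately show ?case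
    using insert.hyps by (simp add: norm_add_square_orthogonal norm_scale)
qed simp

end

section \<open>Selecting a norm-attaining vector\<close>

text \<open>Fixed once for the whole type, so that a vector chosen by least index depends on the
  operator alone, and countably many conditions decide the choice.\<close>

definition dense_seq :: "nat \<Rightarrow> 'a::second_countable_topology" where
  "dense_seq = (SOME D. \<forall>X. open X \<longrightarrow> X \<noteq> {} \<longrightarrow> (\<exists>j. D j \<in> X))"

lemma dense_seq:
  fixes X :: "'a::second_countable_topology set"
  assumes "open X" "X \<noteq> {}"
  obtains j where "dense_seq j \<in> X"
proof -
  obtain D :: "'a set" where D: "countable D" "\<And>X. open X \<Longrightarrow> X \<noteq> {} \<Longrightarrow> \<exists>d\<in>D. d \<in> X"
    by (rule countable_dense_setE) blast
  have "\<exists>j. from_nat_into D j \<in> X" if "open X" "X \<noteq> {}" for X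
    using D(2)[OF that] from_nat_into_surj[OF D(1)] by metis
  then have "\<exists>E::nat \<Rightarrow> 'a. \<forall>X. open X \<longrightarrow> X \<noteq> {} \<longrightarrow> (\<exists>j. E j \<in> X)" by blast
  from someI_ex[OF this] assms that show ?thesis unfolding dense_seq_def by blast
qed

lemma closure_range_dense_seq: "closure (range (dense_seq :: nat \<Rightarrow> 'a::second_countable_topology)) = UNIV"
proof -
  have "- closure (range (dense_seq :: nat \<Rightarrow> 'a)) = {}"
  proof (rule ccontr)
    assume "- closure (range (dense_seq :: nat \<Rightarrow> 'a)) \<noteq> {}"
    then obtain j where "(dense_seq j :: 'a) \<in> - closure (range dense_seq)"
      using dense_seq[of "- closure (range dense_seq)"] by auto
    then show False using closure_subset[of "range dense_seq"] by blast
  qed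
  then show ?thesis by blast
qed

lemma continuous_le_on_dense_seq:
  fixes f g :: "'a::second_countable_topology \<Rightarrow> real"
  assumes "continuous_on UNIV f" "continuous_on UNIV g" "\<And>j. f (dense_seq j) \<le> g (dense_seq j)"
  shows "f x \<le> g x"
proof -
  have "closed {x. f x \<le> g x}" using assms by (intro closed_Collect_le)
  then have "closure (range dense_seq) \<subseteq> {x. f x \<le> g x}"
    using assms(3) by (intro closure_minimal) auto
  then show ?thesis unfolding closure_range_dense_seq by blast
qed

section \<open>Penalized distances and their near minimizers\<close>

definition norm_deficit :: "('a::real_normed_vector \<Rightarrow>\<^sub>L 'b::real_normed_vector) \<Rightarrow> 'a \<Rightarrow> real" where
  "norm_deficit A x = (norm A)\<^sup>2 * (norm x)\<^sup>2 - (norm (A x))\<^sup>2"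

definition penalized_dist ::
  "('a::real_normed_vector \<Rightarrow>\<^sub>L 'b::real_normed_vector) \<Rightarrow> 'a \<Rightarrow> nat \<Rightarrow> 'a \<Rightarrow> real" where
  "penalized_dist A d k x = (norm (x - d))\<^sup>2 + real k * norm_deficit A x"

text \<open>The infimum need not be attained on the dense sequence, hence the slack
  \<open>1 / real (Suc k)\<close>, which tends to 0. The least index keeps the choice measurable in
  \<open>A\<close>.\<close>

definition penalized_vec ::
  "('a::{real_normed_vector,second_countable_topology} \<Rightarrow>\<^sub>L 'b::real_normed_vector) \<Rightarrow> 'a \<Rightarrow> nat \<Rightarrow> 'a"
  where
  "penalized_vec A d k = dense_seq (LEAST j. penalized_dist A d k (dense_seq j)
      < (INF i. penalized_dist A d k (dense_seq i)) + 1 / real (Suc k))"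

definition nearest_top_vec ::
  "('a::{real_normed_vector,second_countable_topology} \<Rightarrow>\<^sub>L 'b::real_normed_vector) \<Rightarrow> 'a \<Rightarrow> 'a" where
  "nearest_top_vec A d = lim (penalized_vec A d)"

text \<open>The value 0 at the zero operator makes the orthogonality of the singular vectors persist
  after the residuals have vanished.\<close>

definition top_vec ::
  "('a::{real_normed_vector,second_countable_topology} \<Rightarrow>\<^sub>L 'b::real_normed_vector) \<Rightarrow> 'a" where
  "top_vec A = (if A = 0 then 0
     else sgn (nearest_top_vec A (dense_seq (LEAST j. nearest_top_vec A (dense_seq j) \<noteq> 0))))"

lemma norm_deficit_nonneg: "0 \<le> norm_deficit A x"
  unfolding norm_deficit_def
  using power_mono[OF norm_blinfun[of A x] norm_ge_zero, of 2] by (simp add: power_mult_distrib)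

lemma penalized_dist_nonneg: "0 \<le> penalized_dist A d k x"
  by (simp add: penalized_dist_def norm_deficit_nonneg)

lemma continuous_penalized_dist: "continuous_on S (penalized_dist A d k)"
  unfolding penalized_dist_def norm_deficit_def by (intro continuous_intros)

text \<open>By continuity the infimum over the dense sequence bounds the whole space from below;
  being countable, it is measurable in \<open>A\<close>.\<close>

lemma INF_penalized_dist_le:
  "(INF i. penalized_dist A d k (dense_seq i)) \<le> penalized_dist A d k x"
proof -
  have "(INF i. penalized_dist A d k (dense_seq i)) \<le> penalized_dist A d k (dense_seq j)" for j
    by (intro cINF_lower) (auto intro!: bdd_belowI[of _ 0] simp: penalized_dist_nonneg)
  then show ?thesis
    by (rule continuous_le_on_dense_seq[rotated 2]) (auto intro: continuous_penalized_dist)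
qed

lemma penalized_vec:
  "penalized_dist A d k (penalized_vec A d k)
    < (INF i. penalized_dist A d k (dense_seq i)) + 1 / real (Suc k)"
proof -
  have "\<exists>j. penalized_dist A d k (dense_seq j)
      < (INF i. penalized_dist A d k (dense_seq i)) + 1 / real (Suc k)"
    using cInf_lessD[of "range (\<lambda>i. penalized_dist A d k (dense_seq i))"
        "(INF i. penalized_dist A d k (dense_seq i)) + 1 / real (Suc k)"] by auto
  from LeastI_ex[OF this] show ?thesis by (simp add: penalized_vec_def)
qed

text \<open>Countably many pointwise conditions decide a bound on the operator norm, so the norm is
  measurable as soon as the values of the operator are.\<close>

lemma norm_blinfun_le_iff_dense_seq:
  fixes A :: "'a::{real_normed_vector,second_countable_topology} \<Rightarrow>\<^sub>L 'b::real_normed_vector"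
  shows "norm A \<le> c \<longleftrightarrow> 0 \<le> c \<and> (\<forall>j. norm (A (dense_seq j)) \<le> c * norm (dense_seq j :: 'a))"
proof (intro iffI conjI allI; (elim conjE)?)
  assume *: "norm A \<le> c"
  then show "0 \<le> c" using norm_ge_zero[of A] by linarith
  show "norm (A (dense_seq j)) \<le> c * norm (dense_seq j :: 'a)" for j
    using norm_blinfun[of A "dense_seq j"] mult_right_mono[OF * norm_ge_zero[of "dense_seq j :: 'a"]]
    by linarith
next
  assume c: "0 \<le> c" and *: "\<forall>j. norm (A (dense_seq j)) \<le> c * norm (dense_seq j :: 'a)"
  have "norm (A x) \<le> c * norm x" for x
    by (rule continuous_le_on_dense_seq[where f = "\<lambda>x. norm (A x)" and g = "\<lambda>x. c * norm x"])
      (use * in \<open>auto intro!: continuous_intros\<close>)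
  then show "norm A \<le> c" using c by (intro norm_blinfun_bound) (auto simp: mult.commute)
qed

section \<open>Measurability of the selection under pointwise measurability\<close>

context
  fixes M :: "'x measure"
    and A :: "'x \<Rightarrow> ('a::{banach,second_countable_topology} \<Rightarrow>\<^sub>L 'b::{banach,second_countable_topology})"
  assumes A [measurable]: "\<And>x. (\<lambda>\<xi>. blinfun_apply (A \<xi>) x) \<in> borel_measurable M"
begin

lemma borel_measurable_norm_blinfun [measurable]: "(\<lambda>\<xi>. norm (A \<xi>)) \<in> borel_measurable M"
  unfolding borel_measurable_iff_le norm_blinfun_le_iff_dense_seq by measurable

lemma borel_measurable_penalized_dist [measurable]:
  "(\<lambda>\<xi>. penalized_dist (A \<xi>) d k x) \<in> borel_measurable M"
  unfolding penalized_dist_def norm_deficit_def by measurable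

text \<open>The least index is a measurable natural number, and a countable family of vectors
  evaluated at a measurable index is measurable.\<close>

lemma borel_measurable_penalized_vec [measurable]:
  "(\<lambda>\<xi>. penalized_vec (A \<xi>) d k) \<in> borel_measurable M"
  unfolding penalized_vec_def
  by (rule measurable_compose_countable[where f = "\<lambda>j _. dense_seq j"]) measurable

lemma borel_measurable_nearest_top_vec [measurable]:
  "(\<lambda>\<xi>. nearest_top_vec (A \<xi>) d) \<in> borel_measurable M"
  unfolding nearest_top_vec_def by measurable

lemma borel_measurable_top_vec: "(\<lambda>\<xi>. top_vec (A \<xi>)) \<in> borel_measurable M"
proof -
  \<comment> \<open>The condition \<open>B = 0\<close> is expressed through the norm: only the
    values of \<open>A\<close>, not \<open>A\<close> as a map into the operators, are known to be
    measurable.\<close>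
  have *: "top_vec B = (if norm B = 0 then 0 else
      inverse (norm (nearest_top_vec B (dense_seq (LEAST j. nearest_top_vec B (dense_seq j) \<noteq> 0))))
      *\<^sub>R nearest_top_vec B (dense_seq (LEAST j. nearest_top_vec B (dense_seq j) \<noteq> 0)))" for B :: "'a \<Rightarrow>\<^sub>L 'b"
    by (simp add: top_vec_def sgn_div_norm)
  have [measurable]: "(\<lambda>\<xi>. nearest_top_vec (A \<xi>)
      (dense_seq (LEAST j. nearest_top_vec (A \<xi>) (dense_seq j) \<noteq> 0))) \<in> borel_measurable M"
    by (rule measurable_compose_countable[where f = "\<lambda>j \<xi>. nearest_top_vec (A \<xi>) (dense_seq j)"])
      measurable
  show ?thesis unfolding * by measurable
qed

text \<open>The functions \<open>g k\<close> take countably many values and converge to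
  \<open>f\<close>. For them the claim reduces to pointwise measurability, and it passes to the
  limit because each \<open>A \<xi>\<close> is continuous.\<close>

lemma borel_measurable_blinfun_apply:
  fixes f :: "'x \<Rightarrow> 'a"
  assumes [measurable]: "f \<in> borel_measurable M"
  shows "(\<lambda>\<xi>. blinfun_apply (A \<xi>) (f \<xi>)) \<in> borel_measurable M"
proof -
  define g :: "nat \<Rightarrow> 'x \<Rightarrow> 'a" where "g k \<xi> = dense_seq (LEAST j. dist (dense_seq j) (f \<xi>) < 1 / real (Suc k))" for k \<xi>
  have lim: "(\<lambda>k. g k \<xi>) \<longlonglongrightarrow> f \<xi>" for \<xi>
  proof (rule metric_LIMSEQ_I)
    have *: "dist (g k \<xi>) (f \<xi>) < 1 / real (Suc k)" for k
    proof -
      obtain j where "dense_seq j \<in> ball (f \<xi>) (1 / real (Suc k))"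
        by (rule dense_seq[of "ball (f \<xi>) (1 / real (Suc k))"]) auto
      then have "dist (dense_seq j) (f \<xi>) < 1 / real (Suc k)" by (simp add: dist_commute)
      then show ?thesis unfolding g_def by (rule LeastI)
    qed
    fix e :: real assume "0 < e"
    then obtain k0 where k0: "1 / real (Suc k0) < e" using nat_approx_posE by blast
    show "\<exists>no. \<forall>k\<ge>no. dist (g k \<xi>) (f \<xi>) < e"
    proof (intro exI allI impI)
      fix k assume "k0 \<le> k"
      then have "1 / real (Suc k) \<le> 1 / real (Suc k0)" by (simp add: field_simps)
      with *[of k] k0 show "dist (g k \<xi>) (f \<xi>) < e" by linarith
    qed
  qed
  have "(\<lambda>\<xi>. blinfun_apply (A \<xi>) (g k \<xi>)) \<in> borel_measurable M" for k
    unfolding g_def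
    by (rule measurable_compose_countable[where f = "\<lambda>j \<xi>. blinfun_apply (A \<xi>) (dense_seq j)"])
      measurable
  then show ?thesis
    by (rule borel_measurable_LIMSEQ_metric[where f = "\<lambda>k \<xi>. blinfun_apply (A \<xi>) (g k \<xi>)"]) (intro blinfun.tendsto tendsto_const lim)
qed

end

section \<open>Compact operators\<close>

locale hilbert_space_pair = H1: hilbert_space sc1 ip1 + H2: hilbert_space sc2 ip2
  for sc1 :: "'k::real_or_complex \<Rightarrow> 'a::{banach,second_countable_topology} \<Rightarrow> 'a"
    and ip1 :: "'a \<Rightarrow> 'a \<Rightarrow> 'k"
    and sc2 :: "'k \<Rightarrow> 'b::{banach,second_countable_topology} \<Rightarrow> 'b"
    and ip2 :: "'b \<Rightarrow> 'b \<Rightarrow> 'k"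
begin

abbreviation tensor :: "'a \<Rightarrow> 'b \<Rightarrow> ('a \<Rightarrow>\<^sub>L 'b)" where
  "tensor \<equiv> rank_one sc2 ip1"

lemma tensor_apply [simp]: "blinfun_apply (tensor u v) x = sc2 (ip1 x u) v"
  by (rule rank_one_apply[OF H1.hilbert_space_axioms H2.hilbert_space_axioms])

section \<open>Closure properties of compact operators\<close>

lemma compact_ops_scale: "A \<in> compact_ops sc1 sc2 \<Longrightarrow> blinfun_apply A (sc1 c x) = sc2 c (blinfun_apply A x)"
  by (simp add: compact_ops_def)

lemma compact_ops_compact: "A \<in> compact_ops sc1 sc2 \<Longrightarrow> bounded S \<Longrightarrow> compact (closure (blinfun_apply A ` S))"
  by (simp add: compact_ops_def)

lemma compact_opsI:
  assumes "\<And>c x. blinfun_apply A (sc1 c x) = sc2 c (blinfun_apply A x)"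
    and "\<And>S. bounded S \<Longrightarrow> \<exists>K. compact K \<and> blinfun_apply A ` S \<subseteq> K"
  shows "A \<in> compact_ops sc1 sc2"
proof -
  have "compact (closure (blinfun_apply A ` S))" if S: "bounded S" for S
  proof -
    obtain K where K: "compact K" "blinfun_apply A ` S \<subseteq> K" using assms(2)[OF S] by blast
    then have "closure (blinfun_apply A ` S) \<subseteq> K" by (intro closure_minimal compact_imp_closed)
    then have "closure (blinfun_apply A ` S) = K \<inter> closure (blinfun_apply A ` S)" by blast
    then show ?thesis using K(1) by (metis compact_Int_closed closed_closure)
  qed
  then show ?thesis using assms(1) by (simp add: compact_ops_def)
qed

lemma compact_ops_diff:
  assumes A: "A \<in> compact_ops sc1 sc2" and B: "B \<in> compact_ops sc1 sc2"
  shows "A - B \<in> compact_ops sc1 sc2"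
proof (rule compact_opsI)
  show "blinfun_apply (A - B) (sc1 c x) = sc2 c (blinfun_apply (A - B) x)" for c x
    by (simp add: blinfun.diff_left compact_ops_scale[OF A] compact_ops_scale[OF B]
        H2.scale_right_diff_distrib)
  fix S :: "'a set" assume S: "bounded S"
  let ?K = "{x - y |x y. x \<in> closure (blinfun_apply A ` S) \<and> y \<in> closure (blinfun_apply B ` S)}"
  have "blinfun_apply (A - B) ` S \<subseteq> ?K"
    by (force simp: blinfun.diff_left intro: closure_subset[THEN subsetD])
  moreover have "compact ?K"
    using compact_ops_compact[OF A S] compact_ops_compact[OF B S] by (rule compact_differences)
  ultimately show "\<exists>K. compact K \<and> blinfun_apply (A - B) ` S \<subseteq> K" by blast
qed

lemma compact_ops_zero [simp]: "0 \<in> compact_ops sc1 sc2"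
  by (rule compact_opsI) (auto intro!: exI[of _ "{0}"])

lemma compact_ops_add:
  "A \<in> compact_ops sc1 sc2 \<Longrightarrow> B \<in> compact_ops sc1 sc2 \<Longrightarrow> A + B \<in> compact_ops sc1 sc2"
  using compact_ops_diff[of A "0 - B"] compact_ops_diff[of 0 B] by simp

lemma continuous_on_scale_left: "continuous_on S (\<lambda>c. sc2 c v)"
proof (rule continuous_on_subset[OF _ subset_UNIV], rule linear_continuous_on,
    rule bounded_linear_intro[where K = "norm v"])
  show "sc2 (r *\<^sub>R c) v = r *\<^sub>R sc2 c v" for r c
    by (metis H2.scale_scale H2.scale_of_real scaleR_conv_of_real)
qed (simp_all add: H2.scale_left_distrib H2.norm_scale)

text \<open>A bounded set is mapped into the continuous image of a closed ball of scalars, which is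
  compact.\<close>

lemma compact_ops_tensor [simp]: "tensor u v \<in> compact_ops sc1 sc2"
proof (rule compact_opsI)
  show "blinfun_apply (tensor u v) (sc1 c x) = sc2 c (blinfun_apply (tensor u v) x)" for c x
    by (simp add: H1.ip_scale_left)
  fix S :: "'a set" assume "bounded S"
  then obtain b where b: "\<And>x. x \<in> S \<Longrightarrow> norm x \<le> b" unfolding bounded_iff by blast
  have "norm (ip1 x u) \<le> b * norm u" if "x \<in> S" for x
    using H1.Cauchy_Schwarz[of x u] mult_right_mono[OF b[OF that] norm_ge_zero[of u]] by linarith
  then have "blinfun_apply (tensor u v) ` S \<subseteq> (\<lambda>c. sc2 c v) ` cball 0 (b * norm u)" by auto
  then show "\<exists>K. compact K \<and> blinfun_apply (tensor u v) ` S \<subseteq> K"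
    using compact_continuous_image[OF continuous_on_scale_left compact_cball_0_real_or_complex]
    by blast
qed

text \<open>Over \<open>'k\<close> the first argument enters conjugate-linearly; over the reals the
  map is bilinear, which gives its joint continuity.\<close>

lemma bounded_bilinear_tensor: "bounded_bilinear tensor"
proof (rule bounded_bilinear.intro)
  show "tensor (u + u') v = tensor u v + tensor u' v" for u u' v
    by (rule blinfun_eqI) (simp add: H1.ip_add_right H2.scale_left_distrib blinfun.add_left)
  show "tensor u (v + v') = tensor u v + tensor u v'" for u v v'
    by (rule blinfun_eqI) (simp add: H2.scale_right_distrib blinfun.add_left)
  show "tensor (r *\<^sub>R u) v = r *\<^sub>R tensor u v" for r u v
    by (rule blinfun_eqI)
      (simp add: H1.ip_scaleR_right blinfun.scaleR_left scaleR_conv_of_real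
        H2.scale_of_real[symmetric])
  show "tensor u (r *\<^sub>R v) = r *\<^sub>R tensor u v" for r u v
    by (rule blinfun_eqI) (simp add: blinfun.scaleR_left H2.scale_scaleR)
  have "norm (tensor u v) \<le> norm u * norm v * 1" for u v
  proof (rule norm_blinfun_bound)
    show "norm (blinfun_apply (tensor u v) x) \<le> norm u * norm v * 1 * norm x" for x
      using mult_right_mono[OF H1.Cauchy_Schwarz[of x u] norm_ge_zero[of v]]
      by (simp add: H2.norm_scale mult_ac)
  qed simp
  then show "\<exists>K. \<forall>u v. norm (tensor u v) \<le> norm u * norm v * K" by blast
qed

section \<open>Attainment of the norm\<close>

lemma compact_op_norm_attained:
  assumes A: "A \<in> compact_ops sc1 sc2" and "A \<noteq> 0"
  obtains e where "norm e = 1" "norm (blinfun_apply A e) = norm A"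
proof -
  have pos: "0 < norm A" using \<open>A \<noteq> 0\<close> by simp
  \<comment> \<open>The offset 2 keeps the factor \<open>1 - 1 / real (k + 2)\<close> positive, so
    that \<open>?c\<close> is an admissible operator bound smaller than
    \<open>norm A\<close>.\<close>
  have "\<exists>x. norm x = 1 \<and> norm A * (1 - 1 / real (k + 2)) < norm (blinfun_apply A x)" for k :: nat
  proof (rule ccontr)
    let ?c = "norm A * (1 - 1 / real (k + 2))"
    assume "\<nexists>x. norm x = 1 \<and> ?c < norm (blinfun_apply A x)"
    then have *: "norm (blinfun_apply A x) \<le> ?c" if "norm x = 1" for x
      using that by (meson not_le)
    have "norm (blinfun_apply A x) \<le> ?c * norm x" for x
    proof (cases "x = 0")
      case False
      then have "norm (blinfun_apply A (x /\<^sub>R norm x)) \<le> ?c" by (intro *) simp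
      then show ?thesis using False by (simp add: blinfun.scaleR_right field_simps)
    qed simp
    then have "norm A \<le> ?c" using pos by (intro norm_blinfun_bound) auto
    moreover have "?c < norm A * 1" using pos by (intro mult_strict_left_mono) auto
    ultimately show False by simp
  qed
  then obtain x where x: "\<And>k. norm (x k) = 1"
    "\<And>k::nat. norm A * (1 - 1 / real (k + 2)) < norm (blinfun_apply A (x k))" by metis
  have "compact (closure (blinfun_apply A ` cball 0 1))"
    using A by (rule compact_ops_compact) simp
  moreover have "\<forall>k. (blinfun_apply A \<circ> x) k \<in> closure (blinfun_apply A ` cball 0 1)"
    using x(1) by (auto intro!: closure_subset[THEN subsetD])
  ultimately obtain l r where r: "strict_mono (r :: nat \<Rightarrow> nat)"
    and l: "((blinfun_apply A \<circ> x) \<circ> r) \<longlonglongrightarrow> l"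
    unfolding compact_def by meson
  define y where "y = x \<circ> r"
  have y: "norm (y k) = 1" for k using x(1) by (simp add: y_def)
  have Ay: "(\<lambda>k. blinfun_apply A (y k)) \<longlonglongrightarrow> l" using l by (simp add: y_def o_def)
  have norm_l: "norm l = norm A"
  proof (rule LIMSEQ_unique[OF tendsto_norm[OF Ay]])
    show "(\<lambda>k. norm (blinfun_apply A (y k))) \<longlonglongrightarrow> norm A"
    proof (rule tendsto_sandwich)
      have *: "(\<lambda>k::nat. norm A * (1 - 1 / real (k + 2))) \<longlonglongrightarrow> norm A * (1 - 0)"
        by (intro tendsto_intros LIMSEQ_ignore_initial_segment[OF lim_1_over_n, of 2])
      show "(\<lambda>k. norm A * (1 - 1 / real (r k + 2))) \<longlonglongrightarrow> norm A"
        using LIMSEQ_subseq_LIMSEQ[OF * r] by (simp add: o_def)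
      show "\<forall>\<^sub>F k in sequentially. norm A * (1 - 1 / real (r k + 2)) \<le> norm (blinfun_apply A (y k))"
        using x(2)[THEN less_imp_le] by (intro always_eventually allI) (simp only: y_def o_def)
      show "\<forall>\<^sub>F k in sequentially. norm (blinfun_apply A (y k)) \<le> norm A"
        using norm_blinfun[of A "y _"] y by auto
    qed simp
  qed
  have "Cauchy y"
  proof (rule metric_CauchyI)
    fix e :: real assume e: "0 < e"
    \<comment> \<open>The parallelogram law will leave \<open>8 * \<eta>\<close> as a bound for the
      squared distance; \<open>\<eta> \<le> 1\<close> allows squaring
      \<open>2 - 2 * \<eta>\<close>.\<close>
    define \<eta> where "\<eta> = min 1 (e\<^sup>2 / 16)"
    have \<eta>: "0 < \<eta>" "\<eta> \<le> 1" "8 * \<eta> < e\<^sup>2" using e by (auto simp: \<eta>_def min_def)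
    obtain N where N: "\<And>k. k \<ge> N \<Longrightarrow> norm (blinfun_apply A (y k) - l) < \<eta> * norm A"
      using LIMSEQ_D[OF Ay, of "\<eta> * norm A"] \<eta> pos by auto
    have "dist (y i) (y j) < e" if "i \<ge> N" "j \<ge> N" for i j
    proof -
      \<comment> \<open>\<open>l\<close> has norm \<open>norm A\<close>; since both images are close
        to \<open>l\<close>, the norm of \<open>y i + y j\<close> must be close to 2.\<close>
      have "norm (l + l) \<le> norm (blinfun_apply A (y i + y j))
          + norm (blinfun_apply A (y i) - l) + norm (blinfun_apply A (y j) - l)"
        using norm_triangle_ineq4[of "blinfun_apply A (y i + y j)"
            "(blinfun_apply A (y i) - l) + (blinfun_apply A (y j) - l)"]
          norm_triangle_ineq[of "blinfun_apply A (y i) - l" "blinfun_apply A (y j) - l"]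
        by (simp add: blinfun.add_right algebra_simps)
      moreover have "norm (l + l) = 2 * norm A" by (simp add: norm_l flip: scaleR_2)
      moreover have "norm (blinfun_apply A (y i + y j)) \<le> norm A * norm (y i + y j)"
        by (rule norm_blinfun)
      ultimately have "norm A * (2 - 2 * \<eta>) \<le> norm A * norm (y i + y j)"
        using N[OF that(1)] N[OF that(2)] by (simp add: algebra_simps)
      then have "2 - 2 * \<eta> \<le> norm (y i + y j)" using pos by simp
      then have "(2 - 2 * \<eta>)\<^sup>2 \<le> (norm (y i + y j))\<^sup>2" using \<eta> by (intro power_mono) auto
      moreover have "(2 - 2 * \<eta>)\<^sup>2 = 4 - 8 * \<eta> + 4 * \<eta>\<^sup>2"
        by (simp add: power2_eq_square algebra_simps)
      ultimately have "4 - 8 * \<eta> \<le> (norm (y i + y j))\<^sup>2"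
        using zero_le_power2[of \<eta>] by linarith
      then have "(norm (y i - y j))\<^sup>2 < e\<^sup>2"
        using H1.parallelogram[of "y i" "y j"] y \<eta> by simp
      then show ?thesis using e by (simp add: dist_norm power2_less_imp_less)
    qed
    then show "\<exists>N. \<forall>i\<ge>N. \<forall>j\<ge>N. dist (y i) (y j) < e" by blast
  qed
  then obtain u where u: "y \<longlonglongrightarrow> u" using Cauchy_convergent convergent_def by blast
  show ?thesis
  proof (rule that)
    show "norm u = 1" using LIMSEQ_unique[OF tendsto_norm[OF u]] y by simp
    have "(\<lambda>k. blinfun_apply A (y k)) \<longlonglongrightarrow> blinfun_apply A u"
      by (intro blinfun.tendsto tendsto_const u)
    then show "norm (blinfun_apply A u) = norm A" using LIMSEQ_unique Ay norm_l by metis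
  qed
qed

section \<open>Convergence of the near minimizers\<close>

lemma norm_deficit_parallelogram:
  fixes A :: "'a \<Rightarrow>\<^sub>L 'b"
  shows "norm_deficit A (x + y) + norm_deficit A (x - y) = 2 * norm_deficit A x + 2 * norm_deficit A y"
proof -
  have "(norm A)\<^sup>2 * ((norm (x + y))\<^sup>2 + (norm (x - y))\<^sup>2)
      = (norm A)\<^sup>2 * (2 * (norm x)\<^sup>2 + 2 * (norm y)\<^sup>2)"
    by (simp only: H1.parallelogram)
  then show ?thesis
    using H2.parallelogram[of "blinfun_apply A x" "blinfun_apply A y"]
    unfolding norm_deficit_def blinfun.add_right blinfun.diff_right by argo
qed

text \<open>Strong convexity: the gain \<open>(norm (x - y))\<^sup>2 / 4\<close> stems from the
  squared distance to \<open>d\<close>, while the deficit, a nonnegative quadratic form, is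
  convex.\<close>

lemma penalized_dist_midpoint:
  fixes A :: "'a \<Rightarrow>\<^sub>L 'b"
  shows "penalized_dist A d k ((1/2) *\<^sub>R (x + y)) + (norm (x - y))\<^sup>2 / 4
    \<le> (penalized_dist A d k x + penalized_dist A d k y) / 2"
proof -
  have half: "norm_deficit A ((1/2) *\<^sub>R z) = norm_deficit A z / 4" for z
    by (simp add: norm_deficit_def blinfun.scaleR_right power_mult_distrib power2_eq_square
        field_simps)
  have "(x - d) + (y - d) = (x + y) - (d + d)" by simp
  then have "(1/2) *\<^sub>R (x + y) - d = (1/2) *\<^sub>R ((x - d) + (y - d))"
    by (simp only: scaleR_diff_right scaleR_half_double)
  then have "(norm ((1/2) *\<^sub>R (x + y) - d))\<^sup>2 = (norm ((x - d) + (y - d)))\<^sup>2 / 4"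
    by (simp add: power2_eq_square)
  moreover have "(norm ((x - d) + (y - d)))\<^sup>2 + (norm (x - y))\<^sup>2
      = 2 * (norm (x - d))\<^sup>2 + 2 * (norm (y - d))\<^sup>2"
    using H1.parallelogram[of "x - d" "y - d"] by simp
  moreover have "real k * norm_deficit A ((1/2) *\<^sub>R (x + y))
      \<le> (real k * norm_deficit A x + real k * norm_deficit A y) / 2"
  proof -
    have "2 * norm_deficit A ((1/2) *\<^sub>R (x + y)) \<le> norm_deficit A x + norm_deficit A y"
      using norm_deficit_parallelogram[of A x y] norm_deficit_nonneg[of A "x - y"]
      unfolding half by linarith
    from mult_left_mono[OF this, of "real k"] show ?thesis by (simp add: algebra_simps)
  qed
  ultimately show ?thesis by (simp add: penalized_dist_def field_simps)
qed

text \<open>The infima \<open>m k\<close> increase with \<open>k\<close> and stay below the squared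
  distance from \<open>d\<close> to \<open>e\<close>, so they are Cauchy, and by the midpoint
  inequality so are the near minimizers. Along them \<open>k\<close> times the deficit stays
  bounded, which forces deficit 0 in the limit. Since \<open>e\<close> is an arbitrary zero, the
  limit is a nearest one.\<close>

lemma nearest_top_vec:
  fixes A :: "'a \<Rightarrow>\<^sub>L 'b"
  assumes e: "norm_deficit A e = 0"
  shows "norm_deficit A (nearest_top_vec A d) = 0"
    and "norm (nearest_top_vec A d - d) \<le> norm (e - d)"
proof -
  define m where "m k = (INF i. penalized_dist A d k (dense_seq i))" for k
  define x where "x k = penalized_vec A d k" for k
  have m_le: "m k \<le> penalized_dist A d k z" for k z
    unfolding m_def by (rule INF_penalized_dist_le)
  have x: "penalized_dist A d k (x k) < m k + 1 / real (Suc k)" for k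
    unfolding m_def x_def by (rule penalized_vec)
  have m_bound: "m k \<le> (norm (e - d))\<^sup>2" for k
    using m_le[of k e] by (simp add: penalized_dist_def e)
  have pd_mono: "penalized_dist A d k z \<le> penalized_dist A d l z" if "k \<le> l" for k l z
    using that norm_deficit_nonneg[of A z] by (simp add: penalized_dist_def mult_right_mono)
  have "incseq m"
    unfolding incseq_def m_def
    by (intro allI impI cINF_mono)
      (auto intro!: pd_mono bdd_belowI[of _ 0] simp: penalized_dist_nonneg)
  then obtain L where "m \<longlonglongrightarrow> L"
    using incseq_convergent[of m "(norm (e - d))\<^sup>2"] m_bound by blast
  then have "Cauchy m" by (rule LIMSEQ_imp_Cauchy)
  \<comment> \<open>The midpoint inequality is used at level \<open>k\<close>; there
    \<open>x l\<close> is minimal up to \<open>m l - m k\<close> and the slack, because the penalty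
    grows with the level.\<close>
  have step: "(norm (x k - x l))\<^sup>2 \<le> 2 * (m l - m k) + 4 * (1 / real (Suc k))" if "k \<le> l" for k l
  proof -
    have "m k + (norm (x k - x l))\<^sup>2 / 4 \<le> (penalized_dist A d k (x k) + penalized_dist A d k (x l)) / 2"
      using m_le[of k "(1/2) *\<^sub>R (x k + x l)"] penalized_dist_midpoint[of A d k "x k" "x l"] by linarith
    moreover have "1 / real (Suc l) \<le> 1 / real (Suc k)" using that by (simp add: field_simps)
    then have "penalized_dist A d k (x l) \<le> m l + 1 / real (Suc k)"
      using pd_mono[OF that, of "x l"] x[of l] by linarith
    moreover have "b \<le> 2 * (c - a) + 4 * t"
      if "a + b / 4 \<le> (p + q) / 2" "q \<le> c + t" "p < a + t" for a b c p q t :: real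
      using that by simp
    ultimately show ?thesis using x[of k] by blast
  qed
  have "Cauchy x"
  proof (rule metric_CauchyI)
    fix r :: real assume r: "0 < r"
    \<comment> \<open>The tolerances satisfy
      \<open>2 * (r\<^sup>2 / 4) + 4 * (r\<^sup>2 / 8) = r\<^sup>2\<close>, matching
      \<open>step\<close>.\<close>
    obtain N1 where N1: "\<And>i j. i \<ge> N1 \<Longrightarrow> j \<ge> N1 \<Longrightarrow> dist (m i) (m j) < r\<^sup>2 / 4"
      using metric_CauchyD[OF \<open>Cauchy m\<close>, of "r\<^sup>2 / 4"] r by auto
    obtain N2 where N2: "1 / real (Suc N2) < r\<^sup>2 / 8"
      using nat_approx_posE[of "r\<^sup>2 / 8"] r by auto
    have le: "dist (x i) (x j) < r" if "max N1 N2 \<le> i" "i \<le> j" for i j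
    proof -
      have "1 / real (Suc i) \<le> 1 / real (Suc N2)" using that by (simp add: field_simps)
      moreover have "\<bar>m i - m j\<bar> < r\<^sup>2 / 4"
        using N1[of i j] that by (simp add: dist_real_def)
      ultimately have "(norm (x i - x j))\<^sup>2 < r\<^sup>2"
        using step[OF that(2)] N2 by argo
      then show ?thesis using r by (simp add: dist_norm power2_less_imp_less)
    qed
    have "dist (x i) (x j) < r" if "i \<ge> max N1 N2" "j \<ge> max N1 N2" for i j
      using le[of i j] le[of j i] that linear[of i j] unfolding dist_commute[of "x j"] by argo
    then show "\<exists>N. \<forall>i\<ge>N. \<forall>j\<ge>N. dist (x i) (x j) < r" by blast
  qed
  then have "x \<longlonglongrightarrow> lim x"
    by (rule convergent_LIMSEQ_iff[THEN iffD1, OF Cauchy_convergent])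
  moreover have "x = penalized_vec A d" by (simp add: x_def fun_eq_iff)
  ultimately have lim: "x \<longlonglongrightarrow> nearest_top_vec A d" by (simp add: nearest_top_vec_def)
  have inverse_lim: "(\<lambda>k. 1 / real (Suc k)) \<longlonglongrightarrow> 0"
    by (rule LIMSEQ_Suc[OF lim_1_over_n])
  have pd_bound: "penalized_dist A d k (x k) \<le> (norm (e - d))\<^sup>2 + 1 / real (Suc k)" for k
    using x[of k] m_bound[of k] by linarith
  have "(norm (nearest_top_vec A d - d))\<^sup>2 \<le> (norm (e - d))\<^sup>2 + 0"
  proof (rule LIMSEQ_le)
    show "(\<lambda>k. (norm (x k - d))\<^sup>2) \<longlonglongrightarrow> (norm (nearest_top_vec A d - d))\<^sup>2"
      by (intro tendsto_intros lim)
    show "(\<lambda>k. (norm (e - d))\<^sup>2 + 1 / real (Suc k)) \<longlonglongrightarrow> (norm (e - d))\<^sup>2 + 0"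
      by (intro tendsto_add tendsto_const inverse_lim)
    have "(norm (x k - d))\<^sup>2 \<le> penalized_dist A d k (x k)" for k
      by (simp add: penalized_dist_def norm_deficit_nonneg)
    then show "\<exists>N. \<forall>k\<ge>N. (norm (x k - d))\<^sup>2 \<le> (norm (e - d))\<^sup>2 + 1 / real (Suc k)"
      by (intro exI allI impI order_trans[OF _ pd_bound])
  qed
  then show "norm (nearest_top_vec A d - d) \<le> norm (e - d)"
    using power2_le_imp_le[of "norm (nearest_top_vec A d - d)" "norm (e - d)"] by simp
  \<comment> \<open>The index is shifted to \<open>Suc k\<close> in order to divide by a positive
    penalty factor.\<close>
  have "norm_deficit A (nearest_top_vec A d) \<le> 0"
  proof (rule LIMSEQ_le)
    show "(\<lambda>k. norm_deficit A (x (Suc k))) \<longlonglongrightarrow> norm_deficit A (nearest_top_vec A d)"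
      unfolding norm_deficit_def by (intro tendsto_intros LIMSEQ_Suc[OF lim])
    show "(\<lambda>k. ((norm (e - d))\<^sup>2 + 1) * (1 / real (Suc k))) \<longlonglongrightarrow> 0"
      using tendsto_mult_left[OF inverse_lim, of "(norm (e - d))\<^sup>2 + 1"] by simp
    have "norm_deficit A (x (Suc k)) \<le> ((norm (e - d))\<^sup>2 + 1) * (1 / real (Suc k))" for k
    proof -
      have "real (Suc k) * norm_deficit A (x (Suc k)) \<le> penalized_dist A d (Suc k) (x (Suc k))"
        unfolding penalized_dist_def by simp
      also have "\<dots> \<le> (norm (e - d))\<^sup>2 + 1 / real (Suc (Suc k))" by (rule pd_bound)
      also have "\<dots> \<le> (norm (e - d))\<^sup>2 + 1" by simp
      finally show ?thesis by (simp add: le_divide_eq mult.commute del: of_nat_Suc)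
    qed
    then show "\<exists>N. \<forall>k\<ge>N. norm_deficit A (x (Suc k)) \<le> ((norm (e - d))\<^sup>2 + 1) * (1 / real (Suc k))"
      by blast
  qed
  then show "norm_deficit A (nearest_top_vec A d) = 0"
    using norm_deficit_nonneg by (rule antisym)
qed

lemma top_vec_zero [simp]: "top_vec 0 = 0"
  by (simp add: top_vec_def)

text \<open>A dense point within 1/2 of a unit maximizer has norm above 1/2, and the nearest zero of
  the deficit lies within 1/2 of that point, hence is nonzero. So the least index in
  \<open>top_vec\<close> exists.\<close>

lemma top_vec:
  assumes A: "A \<in> compact_ops sc1 sc2" and "A \<noteq> 0"
  shows "norm (top_vec A) = 1" and "norm (blinfun_apply A (top_vec A)) = norm A"
proof -
  obtain e where e: "norm e = 1" "norm (blinfun_apply A e) = norm A"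
    using compact_op_norm_attained[OF assms] .
  have e0: "norm_deficit A e = 0" by (simp add: norm_deficit_def e)
  obtain j where "dense_seq j \<in> ball e (1/2)"
    by (rule dense_seq[of "ball e (1/2)"]) auto
  then have j: "norm (e - dense_seq j) < 1/2" by (simp add: dist_norm)
  have "norm (nearest_top_vec A (dense_seq j) - dense_seq j) < 1/2"
    using nearest_top_vec(2)[OF e0, of "dense_seq j"] j by linarith
  then have "nearest_top_vec A (dense_seq j) \<noteq> 0"
    using j e(1) norm_triangle_ineq[of "e - dense_seq j" "dense_seq j"] by auto
  then have ne: "nearest_top_vec A (dense_seq (LEAST j. nearest_top_vec A (dense_seq j) \<noteq> 0)) \<noteq> 0"
    by (rule LeastI)
  define z where "z = nearest_top_vec A (dense_seq (LEAST j. nearest_top_vec A (dense_seq j) \<noteq> 0))"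
  have top: "top_vec A = sgn z" using \<open>A \<noteq> 0\<close> by (simp add: top_vec_def z_def)
  have "norm_deficit A z = 0" unfolding z_def by (rule nearest_top_vec(1)[OF e0])
  then have "(norm (blinfun_apply A z))\<^sup>2 = (norm A * norm z)\<^sup>2"
    by (simp add: norm_deficit_def power_mult_distrib)
  then have "norm (blinfun_apply A z) = norm A * norm z" by simp
  then show "norm (blinfun_apply A (top_vec A)) = norm A"
    using ne by (simp add: top sgn_div_norm blinfun.scaleR_right flip: z_def)
  show "norm (top_vec A) = 1" using ne by (simp add: top norm_sgn flip: z_def)
qed

end

section \<open>Deflation and singular values\<close>

text \<open>The vectors form a family, so two of them may coincide; then their difference is the
  relation. Otherwise \<open>k + 1\<close> distinct vectors in the span of at most \<open>k\<close>
  are dependent.\<close>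

lemma (in vector_space) nontrivial_relation:
  assumes B: "finite B" "card B \<le> k" and y: "\<And>i. i \<le> k \<Longrightarrow> y i \<in> span B"
  obtains c where "\<exists>i\<le>k. c i \<noteq> 0" "(\<Sum>i\<le>k. scale (c i) (y i)) = 0"
proof (cases "inj_on y {..k}")
  case True
  then have "card (y ` {..k}) = Suc k" by (simp add: card_image)
  then have "dependent (y ` {..k})"
    using independent_span_bound[of B "y ` {..k}"] B y by fastforce
  then obtain b where b: "\<exists>v\<in>y ` {..k}. b v \<noteq> 0" "(\<Sum>v\<in>y ` {..k}. scale (b v) v) = 0"
    using dependent_finite[of "y ` {..k}"] by auto
  show ?thesis
  proof (rule that)
    show "\<exists>i\<le>k. (b \<circ> y) i \<noteq> 0" using b(1) by auto
    show "(\<Sum>i\<le>k. scale ((b \<circ> y) i) (y i)) = 0"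
      using b(2) by (simp add: sum.reindex[OF True])
  qed
next
  case False
  then obtain i j where ij: "i \<le> k" "j \<le> k" "i \<noteq> j" "y i = y j"
    unfolding inj_on_def by auto
  define c :: "nat \<Rightarrow> 'a" where "c l = (if l = i then 1 else if l = j then - 1 else 0)" for l
  show ?thesis
  proof (rule that)
    show "\<exists>i\<le>k. c i \<noteq> 0" using ij by (auto simp: c_def)
    have "(\<Sum>l\<le>k. scale (c l) (y l)) = (\<Sum>l\<in>{i, j}. scale (c l) (y l))"
      using ij by (intro sum.mono_neutral_right) (auto simp: c_def)
    also have "\<dots> = 0" using ij by (simp add: c_def)
    finally show "(\<Sum>l\<le>k. scale (c l) (y l)) = 0" .
  qed
qed

section \<open>Rank of sums and differences\<close>

context hilbert_space_pair
begin

text \<open>Trades the dimension for spanning sets, independent or not, so that a sum of operators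
  is handled by a union.\<close>

lemma op_rank_le_iff:
  "op_rank sc2 L \<le> enat k \<longleftrightarrow>
    (\<exists>B. finite B \<and> card B \<le> k \<and> range (blinfun_apply L) \<subseteq> H2.span B)"
proof
  assume *: "op_rank sc2 L \<le> enat k"
  then obtain B where B: "finite B" "range (blinfun_apply L) \<subseteq> H2.span B"
    by (auto simp: op_rank_def split: if_splits)
  then have dim: "H2.dim (range (blinfun_apply L)) \<le> k"
    using * by (auto simp: op_rank_def split: if_splits)
  obtain C where C: "C \<subseteq> range (blinfun_apply L)" "H2.independent C"
    "range (blinfun_apply L) \<subseteq> H2.span C" "card C = H2.dim (range (blinfun_apply L))"
    by (rule H2.basis_exists)
  then have "finite C" using H2.independent_span_bound[OF B(1) C(2)] B(2) by blast
  then show "\<exists>B. finite B \<and> card B \<le> k \<and> range (blinfun_apply L) \<subseteq> H2.span B"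
    using C dim by (intro exI[of _ C]) simp
next
  assume "\<exists>B. finite B \<and> card B \<le> k \<and> range (blinfun_apply L) \<subseteq> H2.span B"
  then obtain B where B: "finite B" "card B \<le> k" "range (blinfun_apply L) \<subseteq> H2.span B" by blast
  then have "H2.dim (range (blinfun_apply L)) \<le> k"
    using H2.dim_le_card[OF B(3,1)] by simp
  then show "op_rank sc2 L \<le> enat k" using B by (auto simp: op_rank_def)
qed

lemma op_rank_add:
  assumes "op_rank sc2 L \<le> enat j" "op_rank sc2 L' \<le> enat k"
  shows "op_rank sc2 (L + L') \<le> enat (j + k)"
proof -
  obtain B B' where B: "finite B" "card B \<le> j" "range (blinfun_apply L) \<subseteq> H2.span B"
    and B': "finite B'" "card B' \<le> k" "range (blinfun_apply L') \<subseteq> H2.span B'"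
    using assms unfolding op_rank_le_iff by blast
  have "blinfun_apply (L + L') x \<in> H2.span (B \<union> B')" for x
    unfolding blinfun.add_left
  proof (rule H2.span_add)
    show "blinfun_apply L x \<in> H2.span (B \<union> B')"
      using B(3) H2.span_mono[of B "B \<union> B'"] by blast
    show "blinfun_apply L' x \<in> H2.span (B \<union> B')"
      using B'(3) H2.span_mono[of B' "B \<union> B'"] by blast
  qed
  moreover have "card (B \<union> B') \<le> j + k" using card_Un_le[of B B'] B B' by linarith
  ultimately show ?thesis unfolding op_rank_le_iff using B B' by (intro exI[of _ "B \<union> B'"]) auto
qed

lemma op_rank_minus: "op_rank sc2 L \<le> enat k \<Longrightarrow> op_rank sc2 (- L) \<le> enat k"
  unfolding op_rank_le_iff by (auto simp: blinfun.minus_left image_subset_iff intro!: H2.span_neg)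

lemma op_rank_diff:
  "op_rank sc2 L \<le> enat j \<Longrightarrow> op_rank sc2 L' \<le> enat k \<Longrightarrow> op_rank sc2 (L - L') \<le> enat (j + k)"
  using op_rank_add[of L j "- L'" k] op_rank_minus[of L' k] by simp

lemma op_rank_zero [simp]: "op_rank sc2 (0 :: 'a \<Rightarrow>\<^sub>L 'b) \<le> enat k"
  unfolding op_rank_le_iff by (auto intro!: exI[of _ "{}"])

lemma op_rank_tensor: "op_rank sc2 (tensor u v) \<le> enat 1"
  unfolding op_rank_le_iff
  by (intro exI[of _ "{v}"]) (auto intro: H2.span_scale[OF H2.span_base])

section \<open>Deflation at a norm-attaining vector\<close>

text \<open>First variation at a maximizer: if the inner product \<open>a\<close> were nonzero,
  moving \<open>u\<close> by a suitable multiple of \<open>x\<close> would raise the squared norm of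
  the image to first order, but that of the vector only to second order.\<close>

lemma image_orthogonal_norm_attained:
  assumes A: "A \<in> compact_ops sc1 sc2" and u: "norm u = 1" "norm (blinfun_apply A u) = norm A"
    and x: "ip1 x u = 0"
  shows "ip2 (blinfun_apply A x) (blinfun_apply A u) = 0"
proof (rule ccontr)
  define a where "a = ip2 (blinfun_apply A x) (blinfun_apply A u)"
  define s where "s = norm A"
  define p where "p = s\<^sup>2 * (norm x)\<^sup>2"
  \<comment> \<open>The factor \<open>conjugate a\<close> makes \<open>t * a\<close> a positive
    real; \<open>r\<close> is small enough that \<open>p * r < 1\<close>, which keeps the
    second-order term below the first-order one.\<close>
  define r where "r = 1 / (1 + p)"
  define t where "t = of_real r * conjugate a"
  assume "ip2 (blinfun_apply A x) (blinfun_apply A u) \<noteq> 0"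
  then have a: "0 < (norm a)\<^sup>2" by (simp add: a_def)
  have p: "0 \<le> p" by (simp add: p_def)
  have r: "0 < r" "p * r < 1" using p by (simp_all add: r_def field_simps)
  have norm_t: "(norm t)\<^sup>2 = r\<^sup>2 * (norm a)\<^sup>2" by (simp add: t_def norm_mult power_mult_distrib)
  have "t * a = of_real (r * (norm a)\<^sup>2)"
    using mult_conjugate[of a] by (simp add: t_def mult_ac)
  then have Re: "Re (to_complex (ip2 (sc2 t (blinfun_apply A x)) (blinfun_apply A u))) = r * (norm a)\<^sup>2"
    by (simp add: H2.ip_scale_left a_def[symmetric] to_complex_of_real del: of_real_mult of_real_power)
  have "s\<^sup>2 + 2 * (r * (norm a)\<^sup>2)
      \<le> (norm (sc2 t (blinfun_apply A x) + blinfun_apply A u))\<^sup>2"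
    unfolding H2.norm_add_square Re by (simp add: u s_def)
  also have "sc2 t (blinfun_apply A x) + blinfun_apply A u = blinfun_apply A (sc1 t x + u)"
    by (simp add: blinfun.add_right compact_ops_scale[OF A])
  also have "(norm (blinfun_apply A (sc1 t x + u)))\<^sup>2 \<le> (s * norm (sc1 t x + u))\<^sup>2"
    unfolding s_def by (intro power_mono norm_blinfun) simp
  also have "\<dots> = s\<^sup>2 * (r\<^sup>2 * (norm a)\<^sup>2 * (norm x)\<^sup>2 + 1)"
    using H1.norm_add_square_orthogonal[of "sc1 t x" u] x u
    by (simp add: power_mult_distrib H1.ip_scale_left H1.norm_scale norm_t)
  also have "\<dots> = s\<^sup>2 + r * (norm a)\<^sup>2 * (p * r)"
    by (simp add: p_def power2_eq_square algebra_simps)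
  also have "\<dots> \<le> s\<^sup>2 + r * (norm a)\<^sup>2 * 1"
    using r a by (intro add_left_mono mult_left_mono) auto
  finally show False using r a by simp
qed

definition deflate :: "('a \<Rightarrow>\<^sub>L 'b) \<Rightarrow> ('a \<Rightarrow>\<^sub>L 'b)" where
  "deflate A = A - tensor (top_vec A) (blinfun_apply A (top_vec A))"

lemma compact_ops_deflate: "A \<in> compact_ops sc1 sc2 \<Longrightarrow> deflate A \<in> compact_ops sc1 sc2"
  unfolding deflate_def by (intro compact_ops_diff compact_ops_tensor)

text \<open>For nonzero \<open>A\<close> this is \<open>A\<close> after the orthogonal projection
  onto the complement of \<open>top_vec A\<close>; the effect on norm, kernel and range is read off
  from it.\<close>

lemma deflate_apply:
  "A \<in> compact_ops sc1 sc2 \<Longrightarrow>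
    blinfun_apply (deflate A) x = blinfun_apply A (x - sc1 (ip1 x (top_vec A)) (top_vec A))"
  by (simp add: deflate_def blinfun.diff_left blinfun.diff_right compact_ops_scale)

lemma deflate_zero [simp]: "deflate 0 = 0"
  by (rule blinfun_eqI) (simp add: deflate_apply)

lemma norm_deflate_le:
  assumes A: "A \<in> compact_ops sc1 sc2"
  shows "norm (deflate A) \<le> norm A"
proof (cases "A = 0")
  case False
  have "norm (blinfun_apply (deflate A) x) \<le> norm A * norm x" for x
  proof -
    let ?y = "x - sc1 (ip1 x (top_vec A)) (top_vec A)"
    have "(norm ?y)\<^sup>2 \<le> (norm x)\<^sup>2"
      using H1.norm_diff_proj_square[OF top_vec(1)[OF A False], of x] by simp
    then have "norm ?y \<le> norm x" by (rule power2_le_imp_le) simp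
    then have "norm A * norm ?y \<le> norm A * norm x" by (intro mult_left_mono) auto
    then show ?thesis using norm_blinfun[of A ?y] by (simp add: deflate_apply[OF A])
  qed
  then show ?thesis by (intro norm_blinfun_bound) auto
qed simp

text \<open>If the maximizer had a nonzero component along a kernel vector, removing it would
  shorten the vector without changing its image, against maximality.\<close>

lemma top_vec_orthogonal_kernel:
  assumes A: "A \<in> compact_ops sc1 sc2" and w: "blinfun_apply A w = 0"
  shows "ip1 w (top_vec A) = 0"
proof (cases "A = 0 \<or> w = 0")
  case False
  define u where "u = top_vec A"
  have u: "norm u = 1" "norm (blinfun_apply A u) = norm A" unfolding u_def using top_vec A False by auto
  define e where "e = w /\<^sub>R norm w"
  have e: "norm e = 1" using False by (simp add: e_def)
  have Ae: "blinfun_apply A e = 0" by (simp add: e_def blinfun.scaleR_right w)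
  let ?y = "u - sc1 (ip1 u e) e"
  have "blinfun_apply A u = blinfun_apply A ?y"
    by (simp add: blinfun.diff_right compact_ops_scale[OF A] Ae)
  then have "norm A * 1 \<le> norm A * norm ?y" using norm_blinfun[of A ?y] u by simp
  then have "1 \<le> norm ?y" using False by simp
  then have "1 \<le> (norm ?y)\<^sup>2" by (rule one_le_power)
  then have "ip1 u e = 0" using H1.norm_diff_proj_square[OF e, of u] u by simp
  then have "ip1 e u = 0" by (simp add: H1.ip_eq_0_commute)
  then show ?thesis using False by (simp add: e_def H1.ip_scaleR_left u_def)
qed auto

lemma deflate_kernel:
  assumes "A \<in> compact_ops sc1 sc2" "blinfun_apply A w = 0"
  shows "blinfun_apply (deflate A) w = 0"
  using top_vec_orthogonal_kernel[OF assms] assms by (simp add: deflate_apply)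

lemma deflate_top_vec:
  assumes A: "A \<in> compact_ops sc1 sc2"
  shows "blinfun_apply (deflate A) (top_vec A) = 0"
proof (cases "A = 0")
  case False
  then show ?thesis by (simp add: deflate_apply[OF A] H1.ip_self top_vec(1)[OF A])
qed simp

lemma deflate_image_orthogonal:
  assumes A: "A \<in> compact_ops sc1 sc2"
  shows "ip2 (blinfun_apply (deflate A) x) (blinfun_apply A (top_vec A)) = 0"
proof (cases "A = 0")
  case False
  have "ip1 (x - sc1 (ip1 x (top_vec A)) (top_vec A)) (top_vec A) = 0"
    by (simp add: H1.ip_diff_left H1.ip_scale_left H1.ip_self top_vec(1)[OF A False])
  then show ?thesis
    unfolding deflate_apply[OF A] by (intro image_orthogonal_norm_attained A top_vec False)
qed simp

section \<open>Residuals and singular vectors\<close>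

definition residual :: "('a \<Rightarrow>\<^sub>L 'b) \<Rightarrow> nat \<Rightarrow> ('a \<Rightarrow>\<^sub>L 'b)" where
  "residual A k = (deflate ^^ k) A"

definition right_vec :: "('a \<Rightarrow>\<^sub>L 'b) \<Rightarrow> nat \<Rightarrow> 'a" where
  "right_vec A k = top_vec (residual A k)"

text \<open>Where the residual vanishes, division by 0 gives the zero vector, so
  \<open>norm_scaleR_left_vec\<close> holds in every case.\<close>

definition left_vec :: "('a \<Rightarrow>\<^sub>L 'b) \<Rightarrow> nat \<Rightarrow> 'b" where
  "left_vec A k = (1 / norm (residual A k)) *\<^sub>R blinfun_apply (residual A k) (right_vec A k)"

lemma residual_0 [simp]: "residual A 0 = A"
  by (simp add: residual_def)

lemma residual_Suc: "residual A (Suc k) = deflate (residual A k)"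
  by (simp add: residual_def)

lemma residual_residual: "residual (residual A n) k = residual A (k + n)"
  by (simp add: residual_def funpow_add)

definition truncation :: "('a \<Rightarrow>\<^sub>L 'b) \<Rightarrow> nat \<Rightarrow> ('a \<Rightarrow>\<^sub>L 'b)" where
  "truncation A n = (\<Sum>i<n. norm (residual A i) *\<^sub>R tensor (right_vec A i) (left_vec A i))"

lemma norm_scaleR_left_vec:
  "norm (residual A k) *\<^sub>R left_vec A k = blinfun_apply (residual A k) (right_vec A k)"
  by (cases "residual A k = 0") (simp_all add: left_vec_def)

text \<open>Each deflation subtracts exactly the next summand, once the factor
  \<open>norm (residual A n)\<close> is absorbed into the second vector.\<close>

lemma diff_truncation: "A - truncation A n = residual A n"
proof (induction n)
  case (Suc n)
  have "norm (residual A n) *\<^sub>R tensor (right_vec A n) (left_vec A n)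
      = tensor (right_vec A n) (blinfun_apply (residual A n) (right_vec A n))"
    by (simp flip: norm_scaleR_left_vec add: bounded_bilinear.scaleR_right[OF bounded_bilinear_tensor])
  then have "truncation A (Suc n)
      = truncation A n + tensor (right_vec A n) (blinfun_apply (residual A n) (right_vec A n))"
    by (simp add: truncation_def)
  then have "A - truncation A (Suc n) = residual A n
      - tensor (right_vec A n) (blinfun_apply (residual A n) (right_vec A n))"
    by (simp flip: Suc.IH)
  then show ?case by (simp add: residual_Suc deflate_def right_vec_def)
qed (simp add: truncation_def)

lemma op_rank_truncation: "op_rank sc2 (truncation A n) \<le> enat n"
proof (induction n)
  case (Suc n)
  have "truncation A (Suc n)
      = truncation A n + tensor (right_vec A n) (norm (residual A n) *\<^sub>R left_vec A n)"
    by (simp add: truncation_def bounded_bilinear.scaleR_right[OF bounded_bilinear_tensor])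
  then show ?case using op_rank_add[OF Suc op_rank_tensor] by simp
qed (simp add: truncation_def)

context
  fixes A :: "'a \<Rightarrow>\<^sub>L 'b"
  assumes A: "A \<in> compact_ops sc1 sc2"
begin

lemma compact_ops_residual: "residual A k \<in> compact_ops sc1 sc2"
  by (induction k) (simp_all add: A residual_Suc compact_ops_deflate)

lemma compact_ops_truncation: "truncation A n \<in> compact_ops sc1 sc2"
proof -
  have "truncation A n = A - residual A n" by (simp flip: diff_truncation)
  then show ?thesis by (simp add: compact_ops_diff A compact_ops_residual)
qed

lemma norm_residual_antimono: "j \<le> k \<Longrightarrow> norm (residual A k) \<le> norm (residual A j)"
  by (induction k rule: dec_induct)
    (auto simp: residual_Suc intro: order_trans[OF norm_deflate_le[OF compact_ops_residual]])

text \<open>\<open>right_vec A j\<close> enters the kernel at stage \<open>Suc j\<close>, and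
  further deflation preserves kernel vectors.\<close>

lemma residual_right_vec_eq_0: "j < k \<Longrightarrow> blinfun_apply (residual A k) (right_vec A j) = 0"
proof (induction k)
  case (Suc k)
  then show ?case
    by (cases "j = k")
      (auto simp: residual_Suc right_vec_def deflate_top_vec deflate_kernel compact_ops_residual)
qed simp

lemma right_vec_orthogonal:
  assumes "i \<noteq> j" shows "ip1 (right_vec A i) (right_vec A j) = 0"
proof -
  have less: "ip1 (right_vec A i) (right_vec A j) = 0" if "i < j" for i j
    using top_vec_orthogonal_kernel[OF compact_ops_residual residual_right_vec_eq_0[OF that]]
    by (simp add: right_vec_def)
  show ?thesis using less[of i j] less[of j i] assms H1.ip_eq_0_commute by (meson linorder_neqE_nat)
qed

lemma norm_right_vec: "residual A k \<noteq> 0 \<Longrightarrow> norm (right_vec A k) = 1"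
  by (simp add: right_vec_def top_vec compact_ops_residual)

lemma norm_left_vec: "residual A k \<noteq> 0 \<Longrightarrow> norm (left_vec A k) = 1"
  by (simp add: left_vec_def right_vec_def top_vec compact_ops_residual)

lemma range_residual: "j \<le> k \<Longrightarrow> range (blinfun_apply (residual A k)) \<subseteq> range (blinfun_apply (residual A j))"
proof (induction k rule: dec_induct)
  case (step k)
  then show ?case by (force simp: residual_Suc deflate_apply compact_ops_residual)
qed simp

text \<open>Ranges shrink under deflation, and that of \<open>residual A (Suc j)\<close> is already
  orthogonal to the vector in question.\<close>

lemma residual_image_orthogonal:
  assumes "j < k"
  shows "ip2 (blinfun_apply (residual A k) x) (blinfun_apply (residual A j) (right_vec A j)) = 0"
proof -
  obtain y where "blinfun_apply (residual A k) x = blinfun_apply (residual A (Suc j)) y"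
    using range_residual[of "Suc j" k] assms by (auto simp: image_subset_iff)
  then show ?thesis
    by (simp add: residual_Suc right_vec_def deflate_image_orthogonal compact_ops_residual)
qed

lemma left_vec_orthogonal:
  assumes "i \<noteq> j" shows "ip2 (left_vec A i) (left_vec A j) = 0"
proof -
  have less: "ip2 (left_vec A i) (left_vec A j) = 0" if "j < i" for i j
    using residual_image_orthogonal[OF that, of "right_vec A i"]
    by (simp add: left_vec_def H2.ip_scaleR_left H2.ip_scaleR_right)
  show ?thesis using less[of i j] less[of j i] assms H2.ip_eq_0_commute by (meson linorder_neqE_nat)
qed

lemma right_vec_orthonormal:
  "residual A i \<noteq> 0 \<Longrightarrow> ip1 (right_vec A i) (right_vec A j) = (if i = j then 1 else 0)"
  by (cases "i = j") (simp_all add: right_vec_orthogonal H1.ip_self norm_right_vec)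

lemma left_vec_orthonormal:
  "residual A i \<noteq> 0 \<Longrightarrow> ip2 (left_vec A i) (left_vec A j) = (if i = j then 1 else 0)"
  by (cases "i = j") (simp_all add: left_vec_orthogonal H2.ip_self norm_left_vec)

text \<open>The summands of \<open>truncation A k\<close> vanish at \<open>right_vec A k\<close> by
  orthogonality, so \<open>A\<close> and \<open>residual A k\<close> agree there.\<close>

lemma apply_right_vec: "blinfun_apply A (right_vec A k) = norm (residual A k) *\<^sub>R left_vec A k"
proof -
  have "blinfun_apply (truncation A k) (right_vec A k) = 0"
    by (simp add: truncation_def blinfun.sum_left blinfun.scaleR_left right_vec_orthogonal)
  then have "blinfun_apply A (right_vec A k) = blinfun_apply (A - truncation A k) (right_vec A k)"
    by (simp add: blinfun.diff_left)
  then show ?thesis by (simp add: diff_truncation norm_scaleR_left_vec)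
qed

section \<open>Optimality of the truncation\<close>

text \<open>Dimension count of Eckart-Young type: \<open>L\<close> annihilates a nonzero combination
  \<open>x\<close> of the first \<open>k + 1\<close> right vectors, and on their span
  \<open>A\<close> stretches by at least the smallest residual norm involved,
  \<open>norm (residual A k)\<close>.\<close>

lemma norm_residual_le:
  assumes L: "L \<in> compact_ops sc1 sc2" and rank: "op_rank sc2 L \<le> enat k"
  shows "norm (residual A k) \<le> norm (A - L)"
proof (cases "residual A k = 0")
  case False
  have ne: "residual A i \<noteq> 0" if "i \<le> k" for i
    using norm_residual_antimono[OF that] False by auto
  obtain B where B: "finite B" "card B \<le> k" "range (blinfun_apply L) \<subseteq> H2.span B"
    using rank unfolding op_rank_le_iff by blast
  obtain c where c: "\<exists>i\<le>k. c i \<noteq> 0"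
    "(\<Sum>i\<le>k. sc2 (c i) (blinfun_apply L (right_vec A i))) = 0"
    using H2.nontrivial_relation[OF B(1,2), of "\<lambda>i. blinfun_apply L (right_vec A i)"] B(3) by blast
  define x where "x = (\<Sum>i\<le>k. sc1 (c i) (right_vec A i))"
  have Lx: "blinfun_apply L x = 0"
    using c(2) by (simp add: x_def blinfun.sum_right compact_ops_scale[OF L])
  have norm_x: "(norm x)\<^sup>2 = (\<Sum>i\<le>k. (norm (c i))\<^sup>2)"
    unfolding x_def using ne by (intro H1.norm_square_sum_orthonormal) (auto simp: right_vec_orthonormal)
  have "0 < (norm x)\<^sup>2"
    unfolding norm_x using c(1) by (force intro: sum_pos2)
  then have pos: "0 < norm x" by (simp add: zero_less_power2)
  \<comment> \<open>The real factor moves into the scalar coefficient, so that Pythagoras applies to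
    the orthonormal left vectors.\<close>
  have "blinfun_apply A x = (\<Sum>i\<le>k. sc2 (c i * of_real (norm (residual A i))) (left_vec A i))"
    by (simp add: x_def blinfun.sum_right compact_ops_scale[OF A] apply_right_vec
        H2.scale_of_real flip: H2.scale_scale)
  then have "(norm (blinfun_apply A x))\<^sup>2 = (\<Sum>i\<le>k. (norm (c i * of_real (norm (residual A i))))\<^sup>2)"
    using ne by (simp only:) (intro H2.norm_square_sum_orthonormal, auto simp: left_vec_orthonormal)
  also have "\<dots> \<ge> (\<Sum>i\<le>k. (norm (residual A k))\<^sup>2 * (norm (c i))\<^sup>2)"
  proof (rule sum_mono)
    fix i assume "i \<in> {..k}"
    then have "(norm (residual A k))\<^sup>2 \<le> (norm (residual A i))\<^sup>2"
      by (intro power_mono norm_residual_antimono) auto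
    then show "(norm (residual A k))\<^sup>2 * (norm (c i))\<^sup>2
        \<le> (norm (c i * of_real (norm (residual A i))))\<^sup>2"
      by (simp add: norm_mult power_mult_distrib mult.commute mult_left_mono)
  qed
  finally have "(norm (residual A k) * norm x)\<^sup>2 \<le> (norm (blinfun_apply A x))\<^sup>2"
    by (simp add: power_mult_distrib norm_x sum_distrib_left)
  then have "norm (residual A k) * norm x \<le> norm (blinfun_apply A x)"
    by (rule power2_le_imp_le) simp
  also have "\<dots> = norm (blinfun_apply (A - L) x)" by (simp add: blinfun.diff_left Lx)
  also have "\<dots> \<le> norm (A - L) * norm x" by (rule norm_blinfun)
  finally show ?thesis using pos by simp
qed simp

lemma INF_norm_diff_rank:
  "(INF L\<in>{L \<in> compact_ops sc1 sc2. op_rank sc2 L \<le> enat n}. norm (A - L)) = norm (residual A n)"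
proof (rule antisym)
  let ?S = "{L \<in> compact_ops sc1 sc2. op_rank sc2 L \<le> enat n}"
  have mem: "truncation A n \<in> ?S" by (simp add: compact_ops_truncation op_rank_truncation)
  have "(INF L\<in>?S. norm (A - L)) \<le> norm (A - truncation A n)"
    using mem by (intro cINF_lower bdd_belowI[of _ 0]) auto
  then show "(INF L\<in>?S. norm (A - L)) \<le> norm (residual A n)" by (simp add: diff_truncation)
  show "norm (residual A n) \<le> (INF L\<in>?S. norm (A - L))"
    using mem by (intro cINF_greatest norm_residual_le) auto
qed

lemma sing_val_Suc: "sing_val sc1 sc2 (Suc k) A = norm (residual A k)"
  by (simp add: sing_val_def INF_norm_diff_rank)

text \<open>The rank hypothesis of the theorem enters here: a vanishing residual would make
  \<open>A\<close> a truncation of rank at most \<open>i\<close>. Nonzero residuals make the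
  singular vectors unit vectors.\<close>

lemma residual_nonzero:
  assumes rank: "enat n \<le> op_rank sc2 A" and "i < n"
  shows "residual A i \<noteq> 0"
proof
  assume "residual A i = 0"
  then have "A = truncation A i" using diff_truncation[of A i] by simp
  then have "op_rank sc2 A \<le> enat i" using op_rank_truncation[of A i] by simp
  then have "enat n \<le> enat i" using rank by (rule order_trans[rotated])
  then show False using \<open>i < n\<close> by simp
qed

end

end

section \<open>Hilbert-Schmidt operators\<close>

text \<open>Every term occurs exactly twice. This serves to bound the residual of index
  \<open>i\<close> of a difference by those of index \<open>i div 2\<close> of its two
  operators.\<close>

lemma summable_div_2:
  fixes f :: "nat \<Rightarrow> real"
  assumes f: "summable f" and nonneg: "\<And>k. 0 \<le> f k"
  shows "summable (\<lambda>i. f (i div 2))"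
proof (rule summableI_nonneg_bounded)
  fix m
  have "(\<Sum>i<m. f (i div 2)) \<le> (\<Sum>i<2 * m. f (i div 2))"
    using nonneg by (intro sum_mono2) auto
  also have "\<dots> = 2 * (\<Sum>k<m. f k)" by (induction m) auto
  also have "\<dots> \<le> 2 * suminf f" using sum_le_suminf[OF f] nonneg by simp
  finally show "(\<Sum>i<m. f (i div 2)) \<le> 2 * suminf f" .
qed (use nonneg in auto)

context hilbert_space_pair
begin

section \<open>Sums of squared singular values as series of residual norms\<close>

context
  fixes A :: "'a \<Rightarrow>\<^sub>L 'b"
  assumes A: "A \<in> compact_ops sc1 sc2"
begin

lemma sing_val_summable_on_iff:
  "(\<lambda>i. (sing_val sc1 sc2 i A)\<^sup>2) summable_on {1..} \<longleftrightarrow> summable (\<lambda>k. (norm (residual A k))\<^sup>2)"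
proof -
  \<comment> \<open>Singular values count from 1, residuals from 0.\<close>
  have "{1..} = range Suc" by (auto simp: image_iff) (metis Suc_le_D)
  then show ?thesis
    by (simp add: summable_on_reindex o_def sing_val_Suc[OF A] summable_on_UNIV_nonneg_real_iff)
qed

lemma infsum_sing_val:
  assumes "summable (\<lambda>k. (norm (residual A k))\<^sup>2)"
  shows "(\<Sum>\<^sub>\<infinity>i\<in>{n + 1..}. (sing_val sc1 sc2 i A)\<^sup>2) = (\<Sum>k. (norm (residual A (k + n)))\<^sup>2)"
proof -
  have "{n + 1..} = range (\<lambda>k. Suc (k + n))"
    by (auto simp: image_iff le_iff_add)
  then have "(\<Sum>\<^sub>\<infinity>i\<in>{n + 1..}. (sing_val sc1 sc2 i A)\<^sup>2) = (\<Sum>\<^sub>\<infinity>k. (norm (residual A (k + n)))\<^sup>2)"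
    by (simp only:) (simp add: infsum_reindex inj_on_def o_def sing_val_Suc[OF A])
  also have "\<dots> = (\<Sum>k. (norm (residual A (k + n)))\<^sup>2)"
    using assms
    by (intro infsumI sums_nonneg_imp_has_sum summable_sums summable_ignore_initial_segment) auto
  finally show ?thesis .
qed

text \<open>The lower bound for approximations, applied with \<open>A\<close> itself as the
  competitor.\<close>

lemma residual_rank_eq_0:
  assumes "op_rank sc2 A \<le> enat m" "m \<le> k"
  shows "residual A k = 0"
  using norm_residual_le[OF A A assms(1)] norm_residual_antimono[OF A assms(2)] by simp

end

lemma hs_ops_iff:
  "A \<in> hs_ops sc1 sc2 \<longleftrightarrow> A \<in> compact_ops sc1 sc2 \<and> summable (\<lambda>k. (norm (residual A k))\<^sup>2)"
  by (auto simp: hs_ops_def sing_val_summable_on_iff simp del: One_nat_def)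

lemma hs_norm_eq:
  "A \<in> hs_ops sc1 sc2 \<Longrightarrow> hs_norm sc1 sc2 A = sqrt (\<Sum>k. (norm (residual A k))\<^sup>2)"
  using infsum_sing_val[of A 0] by (simp add: hs_norm_def hs_ops_iff)

lemma hs_ops_residual: "A \<in> hs_ops sc1 sc2 \<Longrightarrow> residual A n \<in> hs_ops sc1 sc2"
  using summable_ignore_initial_segment[of "\<lambda>k. (norm (residual A k))\<^sup>2" n]
  by (simp add: hs_ops_iff compact_ops_residual residual_residual)

lemma hs_norm_residual:
  assumes "A \<in> hs_ops sc1 sc2"
  shows "hs_norm sc1 sc2 (residual A n) = sqrt (\<Sum>\<^sub>\<infinity>i\<in>{n + 1..}. (sing_val sc1 sc2 i A)\<^sup>2)"
proof -
  have "A \<in> compact_ops sc1 sc2" "summable (\<lambda>k. (norm (residual A k))\<^sup>2)"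
    using assms by (simp_all add: hs_ops_iff)
  from infsum_sing_val[OF this] show ?thesis
    by (simp only: hs_norm_eq[OF hs_ops_residual[OF assms]] residual_residual)
qed

lemma norm_le_hs_norm:
  assumes "A \<in> hs_ops sc1 sc2"
  shows "norm A \<le> hs_norm sc1 sc2 A"
proof -
  have "(norm A)\<^sup>2 = (\<Sum>k\<in>{0}. (norm (residual A k))\<^sup>2)" by simp
  also have "\<dots> \<le> (\<Sum>k. (norm (residual A k))\<^sup>2)"
    using assms by (intro sum_le_suminf) (auto simp: hs_ops_iff)
  finally show ?thesis using assms by (simp add: hs_norm_eq real_le_rsqrt)
qed

lemma finite_rank_hs_ops:
  assumes "L \<in> compact_ops sc1 sc2" "op_rank sc2 L \<le> enat m"
  shows "L \<in> hs_ops sc1 sc2"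
  unfolding hs_ops_iff
proof
  show "summable (\<lambda>k. (norm (residual L k))\<^sup>2)"
    using residual_rank_eq_0[OF assms] by (intro summable_finite[of "{..<m}"]) auto
qed fact

text \<open>At most \<open>m\<close> residuals are nonzero, none with norm above
  \<open>norm L\<close>. This compares the two norms on operators of bounded rank.\<close>

lemma hs_norm_finite_rank:
  assumes "L \<in> compact_ops sc1 sc2" "op_rank sc2 L \<le> enat m"
  shows "hs_norm sc1 sc2 L \<le> sqrt (real m) * norm L"
proof -
  have "(\<Sum>k. (norm (residual L k))\<^sup>2) = (\<Sum>k<m. (norm (residual L k))\<^sup>2)"
    using residual_rank_eq_0[OF assms] by (intro suminf_finite) auto
  also have "\<dots> \<le> (\<Sum>k<m. (norm L)\<^sup>2)"
    using norm_residual_antimono[OF assms(1), of 0] by (intro sum_mono power_mono) auto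
  finally have "(\<Sum>k. (norm (residual L k))\<^sup>2) \<le> real m * (norm L)\<^sup>2" by simp
  then have "hs_norm sc1 sc2 L \<le> sqrt (real m * (norm L)\<^sup>2)"
    using hs_norm_eq[OF finite_rank_hs_ops[OF assms]] by simp
  then show ?thesis by (simp add: real_sqrt_mult)
qed

text \<open>With \<open>k = i div 2\<close>, the difference of the two truncations at
  \<open>k\<close> has rank at most \<open>k + k \<le> i\<close>, so it competes with the truncation
  of \<open>A - B\<close> at \<open>k + k\<close>. Hence the residual of \<open>A - B\<close> at
  \<open>i\<close> is at most the sum of those of \<open>A\<close> and \<open>B\<close> at
  \<open>k\<close>.\<close>

lemma hs_ops_diff:
  assumes A: "A \<in> hs_ops sc1 sc2" and B: "B \<in> hs_ops sc1 sc2"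
  shows "A - B \<in> hs_ops sc1 sc2"
proof -
  have cA: "A \<in> compact_ops sc1 sc2" and cB: "B \<in> compact_ops sc1 sc2"
    using A B by (simp_all add: hs_ops_iff)
  then have cAB: "A - B \<in> compact_ops sc1 sc2" by (rule compact_ops_diff)
  define f where "f k = 2 * (norm (residual A k))\<^sup>2 + 2 * (norm (residual B k))\<^sup>2" for k
  have bound: "(norm (residual (A - B) i))\<^sup>2 \<le> f (i div 2)" for i
  proof -
    define k where "k = i div 2"
    let ?L = "truncation A k - truncation B k"
    have "norm (residual (A - B) i) \<le> norm (residual (A - B) (k + k))"
      by (rule norm_residual_antimono[OF cAB]) (simp add: k_def)
    also have "\<dots> \<le> norm ((A - B) - ?L)"
      by (intro norm_residual_le cAB compact_ops_diff compact_ops_truncation cA cB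
          op_rank_diff op_rank_truncation)
    also have "(A - B) - ?L = residual A k - residual B k"
      by (simp flip: diff_truncation)
    also have "norm \<dots> \<le> norm (residual A k) + norm (residual B k)" by (rule norm_triangle_ineq4)
    finally have "(norm (residual (A - B) i))\<^sup>2 \<le> (norm (residual A k) + norm (residual B k))\<^sup>2"
      by (intro power_mono) auto
    also have "\<dots> \<le> f k"
      using sum_squares_bound[of "norm (residual A k)" "norm (residual B k)"]
      by (simp add: f_def power2_sum)
    finally show ?thesis by (simp add: k_def)
  qed
  have "summable (\<lambda>i. f (i div 2))"
    using A B by (intro summable_div_2) (auto simp: f_def hs_ops_iff intro!: summable_add summable_mult)
  then have "summable (\<lambda>i. (norm (residual (A - B) i))\<^sup>2)"
    by (rule summable_comparison_test') (use bound in simp)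
  then show ?thesis using cAB by (simp add: hs_ops_iff)
qed

text \<open>Adding \<open>L\<close> to the approximations of \<open>A - L\<close> bounds the residuals of \<open>A\<close> termwise, so the
  triangle inequality for the Hilbert-Schmidt norm is not needed.\<close>
lemma hs_norm_residual_le:
  assumes A: "A \<in> hs_ops sc1 sc2" and L: "L \<in> hs_ops sc1 sc2" and rank: "op_rank sc2 L \<le> enat n"
  shows "hs_norm sc1 sc2 (residual A n) \<le> hs_norm sc1 sc2 (A - L)"
proof -
  have AL: "A - L \<in> hs_ops sc1 sc2" using A L by (rule hs_ops_diff)
  have c: "A \<in> compact_ops sc1 sc2" "L \<in> compact_ops sc1 sc2" "A - L \<in> compact_ops sc1 sc2"
    using A L AL by (simp_all add: hs_ops_iff)
  have "norm (residual A (n + k)) \<le> norm (residual (A - L) k)" for k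
  proof -
    have "norm (residual A (n + k)) \<le> norm (A - (L + truncation (A - L) k))"
      by (intro norm_residual_le c compact_ops_add compact_ops_truncation op_rank_add rank
          op_rank_truncation)
    then show ?thesis by (simp add: diff_truncation flip: diff_diff_eq)
  qed
  then have "(norm (residual (residual A n) k))\<^sup>2 \<le> (norm (residual (A - L) k))\<^sup>2" for k
    by (intro power_mono) (simp_all add: residual_residual add.commute)
  then have "(\<Sum>k. (norm (residual (residual A n) k))\<^sup>2) \<le> (\<Sum>k. (norm (residual (A - L) k))\<^sup>2)"
    using hs_ops_residual[OF A, of n] AL by (intro suminf_le) (simp_all add: hs_ops_iff)
  then show ?thesis by (simp add: hs_norm_eq[OF hs_ops_residual[OF A]] hs_norm_eq[OF AL])
qed

lemma hs_ops_truncation: "A \<in> compact_ops sc1 sc2 \<Longrightarrow> truncation A n \<in> hs_ops sc1 sc2"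
  by (rule finite_rank_hs_ops[OF compact_ops_truncation op_rank_truncation])

lemma INF_hs_norm_diff_rank:
  assumes A: "A \<in> hs_ops sc1 sc2"
  shows "(INF L\<in>{L \<in> hs_ops sc1 sc2. op_rank sc2 L \<le> enat n}. hs_norm sc1 sc2 (A - L))
    = hs_norm sc1 sc2 (residual A n)"
proof (rule antisym)
  let ?S = "{L \<in> hs_ops sc1 sc2. op_rank sc2 L \<le> enat n}"
  have mem: "truncation A n \<in> ?S"
    using A by (simp add: hs_ops_iff[of A] hs_ops_truncation op_rank_truncation)
  have "(INF L\<in>?S. hs_norm sc1 sc2 (A - L)) \<le> hs_norm sc1 sc2 (A - truncation A n)"
    using mem hs_norm_residual_le[OF A]
    by (intro cINF_lower bdd_belowI[of _ "hs_norm sc1 sc2 (residual A n)"]) auto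
  then show "(INF L\<in>?S. hs_norm sc1 sc2 (A - L)) \<le> hs_norm sc1 sc2 (residual A n)"
    by (simp add: diff_truncation)
  show "hs_norm sc1 sc2 (residual A n) \<le> (INF L\<in>?S. hs_norm sc1 sc2 (A - L))"
    using mem by (intro cINF_greatest hs_norm_residual_le A) auto
qed

section \<open>Measurability\<close>

lemma space_compact_borel: "space (compact_borel sc1 sc2) = compact_ops sc1 sc2"
  by (simp add: compact_borel_def space_restrict_space)

lemma hs_open_subset_Pow:
  "{U. U \<subseteq> hs_ops sc1 sc2 \<and>
     (\<forall>A\<in>U. \<exists>e>0. \<forall>B\<in>hs_ops sc1 sc2. hs_norm sc1 sc2 (B - A) < e \<longrightarrow> B \<in> U)} \<subseteq> Pow (hs_ops sc1 sc2)"
  by blast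

lemma space_hs_borel: "space (hs_borel sc1 sc2) = hs_ops sc1 sc2"
  unfolding hs_borel_def by (rule space_measure_of[OF hs_open_subset_Pow])

text \<open>The operator norm is dominated by the Hilbert-Schmidt norm, so sets open for the former
  are open for the latter.\<close>

lemma measurable_hs_borel_compact_borel:
  assumes A: "A \<in> M \<rightarrow>\<^sub>M hs_borel sc1 sc2"
  shows "A \<in> M \<rightarrow>\<^sub>M compact_borel sc1 sc2"
proof -
  have "(\<lambda>B. B) \<in> hs_borel sc1 sc2 \<rightarrow>\<^sub>M borel"
  proof (rule borel_measurableI)
    fix S :: "('a \<Rightarrow>\<^sub>L 'b) set" assume S: "open S"
    have "\<exists>e>0. \<forall>C\<in>hs_ops sc1 sc2. hs_norm sc1 sc2 (C - B) < e \<longrightarrow> C \<in> S \<inter> hs_ops sc1 sc2"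
      if B: "B \<in> S \<inter> hs_ops sc1 sc2" for B
    proof -
      obtain e where e: "0 < e" "\<And>C. dist C B < e \<Longrightarrow> C \<in> S"
        using S B unfolding open_dist by blast
      have "C \<in> S" if "C \<in> hs_ops sc1 sc2" "hs_norm sc1 sc2 (C - B) < e" for C
        using norm_le_hs_norm[OF hs_ops_diff[of C B]] that B by (intro e(2)) (simp add: dist_norm)
      then show ?thesis using e(1) by blast
    qed
    then have "S \<inter> hs_ops sc1 sc2 \<in> sets (hs_borel sc1 sc2)"
      unfolding hs_borel_def sets_measure_of[OF hs_open_subset_Pow]
      by (intro sigma_sets.Basic) blast
    then show "(\<lambda>B. B) -` S \<inter> space (hs_borel sc1 sc2) \<in> sets (hs_borel sc1 sc2)"
      by (simp add: space_hs_borel)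
  qed
  then have "A \<in> M \<rightarrow>\<^sub>M borel" using measurable_compose[OF A] by blast
  moreover have "A \<in> space M \<rightarrow> compact_ops sc1 sc2"
    using measurable_space[OF A] by (auto simp: space_hs_borel hs_ops_def)
  ultimately show ?thesis unfolding compact_borel_def by (intro measurable_restrict_space2)
qed

text \<open>On operators of rank at most \<open>n\<close> the two norms are equivalent.\<close>
lemma measurable_hs_borel_finite_rank:
  assumes L: "L \<in> M \<rightarrow>\<^sub>M compact_borel sc1 sc2"
    and rank: "\<And>\<xi>. \<xi> \<in> space M \<Longrightarrow> op_rank sc2 (L \<xi>) \<le> enat n"
  shows "L \<in> M \<rightarrow>\<^sub>M hs_borel sc1 sc2"
  unfolding hs_borel_def
proof (rule measurable_measure_of[OF hs_open_subset_Pow])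
  have cL: "L \<xi> \<in> compact_ops sc1 sc2" if "\<xi> \<in> space M" for \<xi>
    using measurable_space[OF L that] by (simp add: space_compact_borel)
  then have hL: "L \<xi> \<in> hs_ops sc1 sc2" if "\<xi> \<in> space M" for \<xi>
    using that rank finite_rank_hs_ops by blast
  then show "L \<in> space M \<rightarrow> hs_ops sc1 sc2" by blast
  fix U assume "U \<in> {U. U \<subseteq> hs_ops sc1 sc2 \<and>
     (\<forall>A\<in>U. \<exists>e>0. \<forall>B\<in>hs_ops sc1 sc2. hs_norm sc1 sc2 (B - A) < e \<longrightarrow> B \<in> U)}"
  then have U: "U \<subseteq> hs_ops sc1 sc2" and
    "\<forall>A\<in>U. \<exists>e>0. \<forall>B\<in>hs_ops sc1 sc2. hs_norm sc1 sc2 (B - A) < e \<longrightarrow> B \<in> U" by auto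
  then obtain e where e: "\<And>A. A \<in> U \<Longrightarrow> 0 < e A"
    "\<And>A B. A \<in> U \<Longrightarrow> B \<in> hs_ops sc1 sc2 \<Longrightarrow> hs_norm sc1 sc2 (B - A) < e A \<Longrightarrow> B \<in> U"
    by metis
  \<comment> \<open>A difference of two operators of rank at most \<open>n\<close> has rank at most
    \<open>n + n\<close>, hence this constant; adding 1 makes it positive for every
    \<open>n\<close>. The set \<open>W\<close> is open in the operator norm and contains the same
    \<open>L \<xi>\<close> as \<open>U\<close>.\<close>
  define c where "c = sqrt (real (n + n)) + 1"
  have c: "0 < c" by (simp add: c_def add_nonneg_pos)
  define W where "W = (\<Union>A\<in>{A \<in> U. op_rank sc2 A \<le> enat n}. ball A (e A / c))"
  have "L \<xi> \<in> U \<longleftrightarrow> L \<xi> \<in> W" if \<xi>: "\<xi> \<in> space M" for \<xi>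
  proof
    assume "L \<xi> \<in> U"
    then show "L \<xi> \<in> W" using rank[OF \<xi>] e(1)[of "L \<xi>"] c by (auto simp: W_def)
  next
    assume "L \<xi> \<in> W"
    then obtain A where AU: "A \<in> U" and rA: "op_rank sc2 A \<le> enat n"
      and dist: "norm (L \<xi> - A) < e A / c"
      by (auto simp: W_def dist_norm norm_minus_commute)
    have "A \<in> compact_ops sc1 sc2" using AU U by (auto simp: hs_ops_def)
    then have "hs_norm sc1 sc2 (L \<xi> - A) \<le> sqrt (real (n + n)) * norm (L \<xi> - A)"
      by (intro hs_norm_finite_rank compact_ops_diff op_rank_diff cL rank \<xi> rA)
    also have "\<dots> \<le> c * norm (L \<xi> - A)" by (intro mult_right_mono) (simp_all add: c_def)
    also have "\<dots> < e A" using dist c by (simp add: field_simps)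
    finally show "L \<xi> \<in> U" using e(2)[OF AU hL[OF \<xi>]] by blast
  qed
  then have "L -` U \<inter> space M = L -` W \<inter> space M" by blast
  moreover have "L \<in> M \<rightarrow>\<^sub>M borel"
    using L unfolding compact_borel_def by (simp add: measurable_restrict_space2_iff)
  then have "L -` W \<inter> space M \<in> sets M"
    by (rule measurable_sets) (auto simp: W_def intro!: borel_open)
  ultimately show "L -` U \<inter> space M \<in> sets M" by simp
qed

section \<open>Measurable singular systems\<close>

context
  fixes M :: "'x measure" and A :: "'x \<Rightarrow> ('a \<Rightarrow>\<^sub>L 'b)"
  assumes A: "A \<in> M \<rightarrow>\<^sub>M compact_borel sc1 sc2"
begin

lemma compact_ops_measurable: "\<xi> \<in> space M \<Longrightarrow> A \<xi> \<in> compact_ops sc1 sc2"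
  using measurable_space[OF A] by (simp add: space_compact_borel)

text \<open>Pointwise measurability is what the induction carries: it suffices to select
  \<open>top_vec\<close> measurably, and the subtracted term at \<open>x\<close> is a continuous
  function of two measurable vectors.\<close>

lemma borel_measurable_residual_apply:
  "(\<lambda>\<xi>. blinfun_apply (residual (A \<xi>) k) x) \<in> borel_measurable M"
proof (induction k arbitrary: x)
  case 0
  have "A \<in> M \<rightarrow>\<^sub>M borel"
    using A unfolding compact_borel_def by (simp add: measurable_restrict_space2_iff)
  then show ?case
    using measurable_compose[of A M borel "\<lambda>B. blinfun_apply B x" borel]
    by (simp add: borel_measurable_continuous_onI continuous_intros)
next
  case (Suc k)
  note [measurable] = Suc
  define u where "u \<xi> = top_vec (residual (A \<xi>) k)" for \<xi>
  have [measurable]: "u \<in> borel_measurable M"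
    unfolding u_def by (rule borel_measurable_top_vec) measurable
  have [measurable]: "(\<lambda>\<xi>. blinfun_apply (residual (A \<xi>) k) (u \<xi>)) \<in> borel_measurable M"
    by (rule borel_measurable_blinfun_apply) measurable
  have "(\<lambda>\<xi>. blinfun_apply (tensor (u \<xi>) (blinfun_apply (residual (A \<xi>) k) (u \<xi>))) x)
      \<in> borel_measurable M"
    by (rule borel_measurable_continuous_Pair[where H = "\<lambda>u v. blinfun_apply (tensor u v) x"])
      (measurable, intro blinfun.continuous_on continuous_on_const
        bounded_bilinear.continuous_on[OF bounded_bilinear_tensor] continuous_intros)
  then have "(\<lambda>\<xi>. blinfun_apply (residual (A \<xi>) k) x
      - blinfun_apply (tensor (u \<xi>) (blinfun_apply (residual (A \<xi>) k) (u \<xi>))) x) \<in> borel_measurable M"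
    using Suc by measurable
  then show ?case
    by (simp only: residual_Suc deflate_def u_def blinfun.diff_left)
qed

lemma borel_measurable_norm_residual: "(\<lambda>\<xi>. norm (residual (A \<xi>) k)) \<in> borel_measurable M"
  by (rule borel_measurable_norm_blinfun[OF borel_measurable_residual_apply])

lemma borel_measurable_right_vec: "(\<lambda>\<xi>. right_vec (A \<xi>) k) \<in> borel_measurable M"
  unfolding right_vec_def by (rule borel_measurable_top_vec[OF borel_measurable_residual_apply])

lemma borel_measurable_left_vec: "(\<lambda>\<xi>. left_vec (A \<xi>) k) \<in> borel_measurable M"
proof -
  have [measurable]: "(\<lambda>\<xi>. blinfun_apply (residual (A \<xi>) k) (right_vec (A \<xi>) k)) \<in> borel_measurable M"
    by (rule borel_measurable_blinfun_apply[OF borel_measurable_residual_apply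
          borel_measurable_right_vec])
  note [measurable] = borel_measurable_norm_residual
  show ?thesis unfolding left_vec_def by measurable
qed

text \<open>Sums of measurable maps into a non-separable space need not be measurable; instead, the
  truncation is a continuous function of the data in a second countable product space.\<close>
lemma measurable_truncation: "(\<lambda>\<xi>. truncation (A \<xi>) n) \<in> M \<rightarrow>\<^sub>M compact_borel sc1 sc2"
proof -
  define F where "F d = (\<Sum>i<n. fst (d i) *\<^sub>R tensor (fst (snd (d i))) (snd (snd (d i))))"
    for d :: "nat \<Rightarrow> real \<times> 'a \<times> 'b"
  define data where
    "data \<xi> i = (norm (residual (A \<xi>) i), right_vec (A \<xi>) i, left_vec (A \<xi>) i)" for \<xi> i
  have "continuous_on UNIV F"
    unfolding F_def
    by (intro continuous_on_sum continuous_on_scaleR continuous_on_fst continuous_on_snd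
        bounded_bilinear.continuous_on[OF bounded_bilinear_tensor] continuous_on_product_coordinates)
  then have "F \<in> borel_measurable borel" by (rule borel_measurable_continuous_onI)
  moreover have "data \<in> borel_measurable M"
    unfolding data_def
    by (intro measurable_coordinatewise_then_product borel_measurable_Pair
        borel_measurable_norm_residual borel_measurable_right_vec borel_measurable_left_vec)
  ultimately have "(\<lambda>\<xi>. F (data \<xi>)) \<in> borel_measurable M" by (rule measurable_compose[rotated])
  then have "(\<lambda>\<xi>. truncation (A \<xi>) n) \<in> borel_measurable M"
    by (simp add: F_def data_def truncation_def)
  then show ?thesis
    unfolding compact_borel_def
    by (intro measurable_restrict_space2) (auto simp: compact_ops_truncation compact_ops_measurable)
qed

text \<open>Common to both halves of the theorem, which differ only in the norm of the error of the
  truncation.\<close>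

lemma measurable_singular_system:
  assumes rank: "\<And>\<xi>. \<xi> \<in> space M \<Longrightarrow> enat n \<le> op_rank sc2 (A \<xi>)"
  obtains s u v where
    "\<forall>i\<in>{1..n}. s i \<in> M \<rightarrow>\<^sub>M restrict_space borel {0..} \<and>
       u i \<in> M \<rightarrow>\<^sub>M borel \<and> v i \<in> M \<rightarrow>\<^sub>M borel"
    "\<And>\<xi>. \<xi> \<in> space M \<Longrightarrow> \<forall>i\<in>{1..n}. s i \<xi> = sing_val sc1 sc2 i (A \<xi>)"
    "\<And>\<xi>. \<xi> \<in> space M \<Longrightarrow> \<forall>i\<in>{1..n}. \<forall>j\<in>{1..n}.
       ip1 (u i \<xi>) (u j \<xi>) = (if i = j then 1 else 0) \<and>
       ip2 (v i \<xi>) (v j \<xi>) = (if i = j then 1 else 0)"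
    "\<And>\<xi>. (\<Sum>i=1..n. s i \<xi> *\<^sub>R tensor (u i \<xi>) (v i \<xi>)) = truncation (A \<xi>) n"
proof (rule that)
  \<comment> \<open>The theorem counts from 1, the residuals from 0.\<close>
  define s where "s i \<xi> = norm (residual (A \<xi>) (i - 1))" for i :: nat and \<xi>
  define u where "u i \<xi> = right_vec (A \<xi>) (i - 1)" for i :: nat and \<xi>
  define v where "v i \<xi> = left_vec (A \<xi>) (i - 1)" for i :: nat and \<xi>
  show "\<forall>i\<in>{1..n}. s i \<in> M \<rightarrow>\<^sub>M restrict_space borel {0..} \<and>
       u i \<in> M \<rightarrow>\<^sub>M borel \<and> v i \<in> M \<rightarrow>\<^sub>M borel"
    unfolding s_def u_def v_def
    by (auto intro!: measurable_restrict_space2 borel_measurable_norm_residual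
        borel_measurable_right_vec borel_measurable_left_vec)
  show "(\<Sum>i=1..n. s i \<xi> *\<^sub>R tensor (u i \<xi>) (v i \<xi>)) = truncation (A \<xi>) n" for \<xi>
    by (simp add: s_def u_def v_def truncation_def sum.atLeast1_atMost_eq)
  fix \<xi> assume \<xi>: "\<xi> \<in> space M"
  note c = compact_ops_measurable[OF \<xi>]
  show "\<forall>i\<in>{1..n}. s i \<xi> = sing_val sc1 sc2 i (A \<xi>)"
  proof
    fix i assume "i \<in> {1..n}"
    then show "s i \<xi> = sing_val sc1 sc2 i (A \<xi>)"
      using sing_val_Suc[OF c, of "i - 1"] by (simp add: s_def)
  qed
  show "\<forall>i\<in>{1..n}. \<forall>j\<in>{1..n}.
       ip1 (u i \<xi>) (u j \<xi>) = (if i = j then 1 else 0) \<and>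
       ip2 (v i \<xi>) (v j \<xi>) = (if i = j then 1 else 0)"
  proof (intro ballI)
    fix i j assume ij: "i \<in> {1..n}" "j \<in> {1..n}"
    then have "residual (A \<xi>) (i - 1) \<noteq> 0"
      by (intro residual_nonzero[OF c rank[OF \<xi>]]) auto
    \<comment> \<open>Subtraction on the naturals truncates at 0, so this needs \<open>i\<close> and
      \<open>j\<close> to be at least 1.\<close>
    moreover have "i - 1 = j - 1 \<longleftrightarrow> i = j" using ij by auto
    ultimately show "ip1 (u i \<xi>) (u j \<xi>) = (if i = j then 1 else 0) \<and>
       ip2 (v i \<xi>) (v j \<xi>) = (if i = j then 1 else 0)"
      by (simp add: u_def v_def right_vec_orthonormal[OF c] left_vec_orthonormal[OF c])
  qed
qed

end

end

theorem theorem5: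
  fixes M :: "'x measure"
    and sc1 :: "'k::real_or_complex \<Rightarrow> 'a::{banach,second_countable_topology} \<Rightarrow> 'a"
    and ip1 :: "'a \<Rightarrow> 'a \<Rightarrow> 'k"
    and sc2 :: "'k \<Rightarrow> 'b::{banach,second_countable_topology} \<Rightarrow> 'b"
    and ip2 :: "'b \<Rightarrow> 'b \<Rightarrow> 'k"
    and n :: nat
  assumes H1: "hilbert_space sc1 ip1"
    and H2: "hilbert_space sc2 ip2"
    and n: "n \<ge> 1"
  shows
    "(\<forall>A. A \<in> M \<rightarrow>\<^sub>M compact_borel sc1 sc2 \<longrightarrow> (\<forall>\<xi>\<in>space M. op_rank sc2 (A \<xi>) \<ge> enat n) \<longrightarrow>
        (\<exists>(s :: nat \<Rightarrow> 'x \<Rightarrow> real) (u :: nat \<Rightarrow> 'x \<Rightarrow> 'a) (v :: nat \<Rightarrow> 'x \<Rightarrow> 'b).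
          (\<forall>i\<in>{1..n}. s i \<in> M \<rightarrow>\<^sub>M restrict_space borel {0..} \<and>
                      u i \<in> M \<rightarrow>\<^sub>M borel \<and> v i \<in> M \<rightarrow>\<^sub>M borel) \<and>
          (\<forall>\<xi>\<in>space M.
            (\<forall>i\<in>{1..n}. s i \<xi> = sing_val sc1 sc2 i (A \<xi>)) \<and>
            (\<forall>i\<in>{1..n}. \<forall>j\<in>{1..n}.
              ip1 (u i \<xi>) (u j \<xi>) = (if i = j then 1 else 0) \<and>
              ip2 (v i \<xi>) (v j \<xi>) = (if i = j then 1 else 0)) \<and>
            norm (A \<xi> - (\<Sum>i=1..n. s i \<xi> *\<^sub>R rank_one sc2 ip1 (u i \<xi>) (v i \<xi>)))
              = (INF L\<in>{L \<in> compact_ops sc1 sc2. op_rank sc2 L \<le> enat n}. norm (A \<xi> - L)) \<and>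
            (INF L\<in>{L \<in> compact_ops sc1 sc2. op_rank sc2 L \<le> enat n}. norm (A \<xi> - L))
              = sing_val sc1 sc2 (n + 1) (A \<xi>))) \<and>
        (\<exists>A'. A' \<in> M \<rightarrow>\<^sub>M compact_borel sc1 sc2 \<and>
          (\<forall>\<xi>\<in>space M.
            is_arg_min (\<lambda>L. norm (A \<xi> - L))
              (\<lambda>L. L \<in> compact_ops sc1 sc2 \<and> op_rank sc2 L \<le> enat n) (A' \<xi>)))) \<and>
     (\<forall>A. A \<in> M \<rightarrow>\<^sub>M hs_borel sc1 sc2 \<longrightarrow> (\<forall>\<xi>\<in>space M. op_rank sc2 (A \<xi>) \<ge> enat n) \<longrightarrow>
        (\<exists>(s :: nat \<Rightarrow> 'x \<Rightarrow> real) (u :: nat \<Rightarrow> 'x \<Rightarrow> 'a) (v :: nat \<Rightarrow> 'x \<Rightarrow> 'b).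
          (\<forall>i\<in>{1..n}. s i \<in> M \<rightarrow>\<^sub>M restrict_space borel {0..} \<and>
                      u i \<in> M \<rightarrow>\<^sub>M borel \<and> v i \<in> M \<rightarrow>\<^sub>M borel) \<and>
          (\<forall>\<xi>\<in>space M.
            (\<forall>i\<in>{1..n}. s i \<xi> = sing_val sc1 sc2 i (A \<xi>)) \<and>
            (\<forall>i\<in>{1..n}. \<forall>j\<in>{1..n}.
              ip1 (u i \<xi>) (u j \<xi>) = (if i = j then 1 else 0) \<and>
              ip2 (v i \<xi>) (v j \<xi>) = (if i = j then 1 else 0)) \<and>
            hs_norm sc1 sc2 (A \<xi> - (\<Sum>i=1..n. s i \<xi> *\<^sub>R rank_one sc2 ip1 (u i \<xi>) (v i \<xi>)))
              = (INF L\<in>{L \<in> hs_ops sc1 sc2. op_rank sc2 L \<le> enat n}. hs_norm sc1 sc2 (A \<xi> - L)) \<and>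
            (INF L\<in>{L \<in> hs_ops sc1 sc2. op_rank sc2 L \<le> enat n}. hs_norm sc1 sc2 (A \<xi> - L))
              = sqrt (\<Sum>\<^sub>\<infinity>i\<in>{n+1..}. (sing_val sc1 sc2 i (A \<xi>))\<^sup>2))) \<and>
        (\<exists>A'. A' \<in> M \<rightarrow>\<^sub>M hs_borel sc1 sc2 \<and>
          (\<forall>\<xi>\<in>space M.
            is_arg_min (\<lambda>L. hs_norm sc1 sc2 (A \<xi> - L))
              (\<lambda>L. L \<in> hs_ops sc1 sc2 \<and> op_rank sc2 L \<le> enat n) (A' \<xi>))))"
proof -
  interpret hilbert_space_pair sc1 ip1 sc2 ip2
    unfolding hilbert_space_pair_def using H1 H2 by blast
  show ?thesis
  proof (intro conjI allI impI)
    fix A :: "'x \<Rightarrow> ('a \<Rightarrow>\<^sub>L 'b)"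
    assume A: "A \<in> M \<rightarrow>\<^sub>M compact_borel sc1 sc2"
      and rank: "\<forall>\<xi>\<in>space M. op_rank sc2 (A \<xi>) \<ge> enat n"
    note c = compact_ops_measurable[OF A]
    obtain s u v where suv:
      "\<forall>i\<in>{1..n}. s i \<in> M \<rightarrow>\<^sub>M restrict_space borel {0..} \<and>
         u i \<in> M \<rightarrow>\<^sub>M borel \<and> v i \<in> M \<rightarrow>\<^sub>M borel"
      "\<And>\<xi>. \<xi> \<in> space M \<Longrightarrow> \<forall>i\<in>{1..n}. s i \<xi> = sing_val sc1 sc2 i (A \<xi>)"
      "\<And>\<xi>. \<xi> \<in> space M \<Longrightarrow> \<forall>i\<in>{1..n}. \<forall>j\<in>{1..n}.
         ip1 (u i \<xi>) (u j \<xi>) = (if i = j then 1 else 0) \<and>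
         ip2 (v i \<xi>) (v j \<xi>) = (if i = j then 1 else 0)"
      "\<And>\<xi>. (\<Sum>i=1..n. s i \<xi> *\<^sub>R tensor (u i \<xi>) (v i \<xi>)) = truncation (A \<xi>) n"
      using measurable_singular_system[OF A] rank by blast
    show "\<exists>s u v.
          (\<forall>i\<in>{1..n}. s i \<in> M \<rightarrow>\<^sub>M restrict_space borel {0..} \<and>
                      u i \<in> M \<rightarrow>\<^sub>M borel \<and> v i \<in> M \<rightarrow>\<^sub>M borel) \<and>
          (\<forall>\<xi>\<in>space M.
            (\<forall>i\<in>{1..n}. s i \<xi> = sing_val sc1 sc2 i (A \<xi>)) \<and>
            (\<forall>i\<in>{1..n}. \<forall>j\<in>{1..n}.
              ip1 (u i \<xi>) (u j \<xi>) = (if i = j then 1 else 0) \<and>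
              ip2 (v i \<xi>) (v j \<xi>) = (if i = j then 1 else 0)) \<and>
            norm (A \<xi> - (\<Sum>i=1..n. s i \<xi> *\<^sub>R tensor (u i \<xi>) (v i \<xi>)))
              = (INF L\<in>{L \<in> compact_ops sc1 sc2. op_rank sc2 L \<le> enat n}. norm (A \<xi> - L)) \<and>
            (INF L\<in>{L \<in> compact_ops sc1 sc2. op_rank sc2 L \<le> enat n}. norm (A \<xi> - L))
              = sing_val sc1 sc2 (n + 1) (A \<xi>))"
      \<comment> \<open>The error, the infimum and the singular value all reduce to
        \<open>norm (residual (A \<xi>) n)\<close>.\<close>
      by (rule exI[of _ s], rule exI[of _ u], rule exI[of _ v], rule conjI[OF suv(1)], rule ballI,
          intro conjI suv(2,3))
        (simp_all only: suv(4) diff_truncation c INF_norm_diff_rank sing_val_Suc flip: Suc_eq_plus1)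
    show "\<exists>A'. A' \<in> M \<rightarrow>\<^sub>M compact_borel sc1 sc2 \<and>
          (\<forall>\<xi>\<in>space M.
            is_arg_min (\<lambda>L. norm (A \<xi> - L))
              (\<lambda>L. L \<in> compact_ops sc1 sc2 \<and> op_rank sc2 L \<le> enat n) (A' \<xi>))"
      using measurable_truncation[OF A, of n]
      by (intro exI[of _ "\<lambda>\<xi>. truncation (A \<xi>) n"])
        (auto simp: is_arg_min_def not_less diff_truncation c compact_ops_truncation
          op_rank_truncation intro!: norm_residual_le)
  next
    fix A :: "'x \<Rightarrow> ('a \<Rightarrow>\<^sub>L 'b)"
    assume hs: "A \<in> M \<rightarrow>\<^sub>M hs_borel sc1 sc2"
      and rank: "\<forall>\<xi>\<in>space M. op_rank sc2 (A \<xi>) \<ge> enat n"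
    \<comment> \<open>Measurability for the Hilbert-Schmidt norm implies that for the operator norm,
      so the singular system of the first half is available.\<close>
    note A = measurable_hs_borel_compact_borel[OF hs]
    note c = compact_ops_measurable[OF A]
    have h: "A \<xi> \<in> hs_ops sc1 sc2" if "\<xi> \<in> space M" for \<xi>
      using measurable_space[OF hs that] by (simp add: space_hs_borel)
    obtain s u v where suv:
      "\<forall>i\<in>{1..n}. s i \<in> M \<rightarrow>\<^sub>M restrict_space borel {0..} \<and>
         u i \<in> M \<rightarrow>\<^sub>M borel \<and> v i \<in> M \<rightarrow>\<^sub>M borel"
      "\<And>\<xi>. \<xi> \<in> space M \<Longrightarrow> \<forall>i\<in>{1..n}. s i \<xi> = sing_val sc1 sc2 i (A \<xi>)"
      "\<And>\<xi>. \<xi> \<in> space M \<Longrightarrow> \<forall>i\<in>{1..n}. \<forall>j\<in>{1..n}.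
         ip1 (u i \<xi>) (u j \<xi>) = (if i = j then 1 else 0) \<and>
         ip2 (v i \<xi>) (v j \<xi>) = (if i = j then 1 else 0)"
      "\<And>\<xi>. (\<Sum>i=1..n. s i \<xi> *\<^sub>R tensor (u i \<xi>) (v i \<xi>)) = truncation (A \<xi>) n"
      using measurable_singular_system[OF A] rank by blast
    show "\<exists>s u v.
          (\<forall>i\<in>{1..n}. s i \<in> M \<rightarrow>\<^sub>M restrict_space borel {0..} \<and>
                      u i \<in> M \<rightarrow>\<^sub>M borel \<and> v i \<in> M \<rightarrow>\<^sub>M borel) \<and>
          (\<forall>\<xi>\<in>space M.
            (\<forall>i\<in>{1..n}. s i \<xi> = sing_val sc1 sc2 i (A \<xi>)) \<and>
            (\<forall>i\<in>{1..n}. \<forall>j\<in>{1..n}.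
              ip1 (u i \<xi>) (u j \<xi>) = (if i = j then 1 else 0) \<and>
              ip2 (v i \<xi>) (v j \<xi>) = (if i = j then 1 else 0)) \<and>
            hs_norm sc1 sc2 (A \<xi> - (\<Sum>i=1..n. s i \<xi> *\<^sub>R tensor (u i \<xi>) (v i \<xi>)))
              = (INF L\<in>{L \<in> hs_ops sc1 sc2. op_rank sc2 L \<le> enat n}. hs_norm sc1 sc2 (A \<xi> - L)) \<and>
            (INF L\<in>{L \<in> hs_ops sc1 sc2. op_rank sc2 L \<le> enat n}. hs_norm sc1 sc2 (A \<xi> - L))
              = sqrt (\<Sum>\<^sub>\<infinity>i\<in>{n+1..}. (sing_val sc1 sc2 i (A \<xi>))\<^sup>2))"
      by (rule exI[of _ s], rule exI[of _ u], rule exI[of _ v], rule conjI[OF suv(1)], rule ballI,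
          intro conjI suv(2,3))
        (simp_all only: suv(4) diff_truncation h INF_hs_norm_diff_rank hs_norm_residual)
    show "\<exists>A'. A' \<in> M \<rightarrow>\<^sub>M hs_borel sc1 sc2 \<and>
          (\<forall>\<xi>\<in>space M.
            is_arg_min (\<lambda>L. hs_norm sc1 sc2 (A \<xi> - L))
              (\<lambda>L. L \<in> hs_ops sc1 sc2 \<and> op_rank sc2 L \<le> enat n) (A' \<xi>))"
      \<comment> \<open>The truncation is measurable for the operator norm and has rank at most
        \<open>n\<close>, which lifts its measurability to the Hilbert-Schmidt norm.\<close>
      using measurable_hs_borel_finite_rank[OF measurable_truncation[OF A, of n] op_rank_truncation]
      by (intro exI[of _ "\<lambda>\<xi>. truncation (A \<xi>) n"])
        (auto simp: is_arg_min_def not_less diff_truncation c h hs_ops_truncation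
          op_rank_truncation intro!: hs_norm_residual_le)
  qed
qed

end
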